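(* Let $A$ be a torsion-free abelian group and $G$ a group acting on $A$ by automorphisms such that every $G$-orbit in $A$ is finite. If $\mathrm{C}(\hat A)^G \cong \mathrm{C}(\mathbb{T}^n)$ for some $n \in \mathbb{N}$, then $A \cong \mathbb{Z}^n$ and $G$ acts trivially on $A$.
   Context: $\hat A = \mathrm{Hom}(A, \mathrm{S}^1)$ is the Pontryagin dual, a compact abelian group with the topology of pointwise convergence. Each automorphism $\alpha$ of $A$ induces a continuous automorphism $\chi \mapsto \chi\circ\alpha$ of $\hat A$, so $G$ acts on $\hat A$ and thus by *-automorphisms on $\mathrm{C}(\hat A)$ (equivalently on $\mathrm{C}^*(A) \cong \mathrm{C}(\hat A)$ via the Fourier transform). $\mathrm{C}(\hat A)^G$ denotes the fixed point algebra $\{x \mid gx = x \text{ for all } g \in G\}$. *)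

theory Defs
  imports "HOL-Analysis.Analysis" "HOL-Algebra.Group_Action" "HOL-Algebra.Elementary_Groups"
    "HOL-Algebra.Product_Groups"
begin

definition circle :: "complex set" where
  "circle = {z. cmod z = 1}"

definition torsion_free :: "('a, 'b) monoid_scheme \<Rightarrow> bool" where
  "torsion_free A \<longleftrightarrow> (\<forall>a\<in>carrier A. \<forall>n::nat. n > 0 \<longrightarrow> a [^]\<^bsub>A\<^esub> n = \<one>\<^bsub>A\<^esub> \<longrightarrow> a = \<one>\<^bsub>A\<^esub>)"

definition characters :: "('a, 'b) monoid_scheme \<Rightarrow> ('a \<Rightarrow> complex) set" where
  "characters A = {\<gamma> \<in> (\<Pi>\<^sub>E a\<in>carrier A. circle).
      \<forall>x\<in>carrier A. \<forall>y\<in>carrier A. \<gamma> (x \<otimes>\<^bsub>A\<^esub> y) = \<gamma> x * \<gamma> y}"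

definition pontryagin_dual :: "('a, 'b) monoid_scheme \<Rightarrow> ('a \<Rightarrow> complex) topology" where
  "pontryagin_dual A =
     subtopology (product_topology (\<lambda>_. top_of_set circle) (carrier A)) (characters A)"

definition torus :: "nat \<Rightarrow> (nat \<Rightarrow> complex) topology" where
  "torus n = product_topology (\<lambda>_. top_of_set circle) {..<n}"

definition cont_fun :: "'x topology \<Rightarrow> ('x \<Rightarrow> complex) set" where
  "cont_fun X = {f. continuous_map X euclidean f \<and> (\<forall>x. x \<notin> topspace X \<longrightarrow> f x = 0)}"

text \<open>*-isomorphism between *-subalgebras of pointwise function algebras.
  (Algebraic *-isomorphisms between C*-algebras are automatically isometric.)\<close>
definition star_iso :: "(('x \<Rightarrow> complex) \<Rightarrow> ('y \<Rightarrow> complex)) \<Rightarrow> ('x \<Rightarrow> complex) set \<Rightarrow> ('y \<Rightarrow> complex) set \<Rightarrow> bool" where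
  "star_iso \<Phi> S T \<longleftrightarrow> bij_betw \<Phi> S T \<and>
     (\<forall>f\<in>S. \<forall>g\<in>S. \<Phi> (\<lambda>x. f x + g x) = (\<lambda>y. \<Phi> f y + \<Phi> g y)) \<and>
     (\<forall>f\<in>S. \<forall>g\<in>S. \<Phi> (\<lambda>x. f x * g x) = (\<lambda>y. \<Phi> f y * \<Phi> g y)) \<and>
     (\<forall>c. \<forall>f\<in>S. \<Phi> (\<lambda>x. c * f x) = (\<lambda>y. c * \<Phi> f y)) \<and>
     (\<forall>f\<in>S. \<Phi> (\<lambda>x. cnj (f x)) = (\<lambda>y. cnj (\<Phi> f y)))"

definition star_isomorphic :: "('x \<Rightarrow> complex) set \<Rightarrow> ('y \<Rightarrow> complex) set \<Rightarrow> bool" where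
  "star_isomorphic S T \<longleftrightarrow> (\<exists>\<Phi>. star_iso \<Phi> S T)"

definition dual_action :: "('a, 'b) monoid_scheme \<Rightarrow> ('a \<Rightarrow> 'a) \<Rightarrow> ('a \<Rightarrow> complex) \<Rightarrow> ('a \<Rightarrow> complex)" where
  "dual_action A \<alpha> \<gamma> = restrict (\<gamma> \<circ> \<alpha>) (carrier A)"

definition fixed_point_algebra ::
  "('g, 'c) monoid_scheme \<Rightarrow> ('a, 'b) monoid_scheme \<Rightarrow> ('g \<Rightarrow> 'a \<Rightarrow> 'a) \<Rightarrow> (('a \<Rightarrow> complex) \<Rightarrow> complex) set" where
  "fixed_point_algebra G A \<phi> =
     {f \<in> cont_fun (pontryagin_dual A).
        \<forall>g\<in>carrier G. \<forall>\<gamma>\<in>topspace (pontryagin_dual A). f (dual_action A (\<phi> g) \<gamma>) = f \<gamma>}"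

end

theory Submission
  imports Defs "HOL-Homology.Invariance_of_Domain"
begin

text \<open>
  Evaluating the inverse isomorphism at a character of \<open>A\<close> gives a continuous map \<open>p\<close> from the
  dual of \<open>A\<close> to the \<open>n\<close>-torus such that pullback along \<open>p\<close> inverts the given isomorphism; two
  characters with the same image under \<open>p\<close> agree, on every finite set, up to the action of \<open>G\<close>.

  Every circle-valued continuous function on the dual of \<open>A\<close> is uniquely an evaluation at an element
  of \<open>A\<close> times the exponential of an imaginary continuous function, and similarly on the torus with
  the coordinate monomials. Comparing the two through \<open>p\<close> shows that the elements \<open>b\<^sub>i\<close> belonging to
  the \<open>n\<close> coordinates of \<open>p\<close> form a basis of the group of \<open>G\<close>-fixed elements.

  If some \<open>a\<close> were not fixed, then \<open>b\<^sub>1, \<dots>, b\<^sub>n, a\<close> would be independent because \<open>A\<close> is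
  torsion-free, so homomorphisms from \<open>A\<close> to the reals dual to them would give an
  \<open>(n + 1)\<close>-parameter family of characters. Near a generic parameter \<open>p\<close> is injective on this
  family, which contradicts invariance of domain.
\<close>

section \<open>Real-valued homomorphisms and independent elements\<close>

text \<open>The group need not be finitely generated, so its dual need not be a manifold, nor even
  path connected, and phases cannot be lifted on it directly. Finite subsets of the group generate
  free subgroups, however, and a character is determined there by real arguments on a basis; the
  coordinate functionals of that basis extend to the whole group. The characters exp(i t), with t in
  \<open>real_homs\<close>, are therefore dense, and the lines s -> exp(i s t) join them to the
  trivial character. The factorisation is unique because evaluation at a nontrivial element has a
  phase that grows without bound along such a line, while a continuous phase on the compact dual is
  bounded. For the dimension bound, a group element identifying two members of the family gives a
  linear relation modulo 2 pi between their parameters. Finite orbits leave only finitely many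
  relations. At a parameter off the hyperplanes defined by the nontrivial ones, none of these can
  hold between two nearby points.\<close>

definition real_homs :: "('a, 'b) monoid_scheme \<Rightarrow> ('a \<Rightarrow> real) set" where
  "real_homs G = {t. \<forall>x\<in>carrier G. \<forall>y\<in>carrier G. t (x \<otimes>\<^bsub>G\<^esub> y) = t x + t y}"

text \<open>The exponents form a total function of which only the values below \<open>m\<close>
  count. Coefficients can thus be changed by a function update, and the subgroup generated by the
  first \<open>m\<close> members of \<open>b\<close> is
  \<open>range (lincomb G b m)\<close>.\<close>

definition lincomb :: "('a, 'b) monoid_scheme \<Rightarrow> (nat \<Rightarrow> 'a) \<Rightarrow> nat \<Rightarrow> (nat \<Rightarrow> int) \<Rightarrow> 'a" where
  "lincomb G b m c = finprod G (\<lambda>i. b i [^]\<^bsub>G\<^esub> c i) {..<m}"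

text \<open>The functionals certify that the \<open>b i\<close> are independent over the integers,
  and they also parametrise characters with prescribed values on the \<open>b i\<close>. They are
  defined on all of \<open>G\<close>, not merely on the span.\<close>

definition dual_family :: "('a, 'b) monoid_scheme \<Rightarrow> (nat \<Rightarrow> 'a) \<Rightarrow> (nat \<Rightarrow> 'a \<Rightarrow> real) \<Rightarrow> nat \<Rightarrow> bool" where
  "dual_family G b t m \<longleftrightarrow> (\<forall>i<m. b i \<in> carrier G \<and> t i \<in> real_homs G \<and>
     (\<forall>j<m. t i (b j) = (if i = j then 1 else 0)))"

lemma real_homsD:
  "t \<in> real_homs G \<Longrightarrow> x \<in> carrier G \<Longrightarrow> y \<in> carrier G \<Longrightarrow> t (x \<otimes>\<^bsub>G\<^esub> y) = t x + t y"
  by (simp add: real_homs_def)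

lemma real_homs_sum:
  assumes "\<And>i. i \<in> I \<Longrightarrow> t i \<in> real_homs G"
  shows "(\<lambda>a. \<Sum>i\<in>I. x i * t i a) \<in> real_homs G"
proof -
  have "(\<Sum>i\<in>I. x i * t i (u \<otimes>\<^bsub>G\<^esub> v)) = (\<Sum>i\<in>I. x i * t i u) + (\<Sum>i\<in>I. x i * t i v)"
    if "u \<in> carrier G" "v \<in> carrier G" for u v
  proof -
    have "(\<Sum>i\<in>I. x i * t i (u \<otimes>\<^bsub>G\<^esub> v)) = (\<Sum>i\<in>I. x i * t i u + x i * t i v)"
      by (intro sum.cong refl) (simp add: real_homsD[OF assms] that algebra_simps)
    then show ?thesis by (simp add: sum.distrib)
  qed
  then show ?thesis by (simp add: real_homs_def)
qed

lemma real_homs_scale: "t \<in> real_homs G \<Longrightarrow> (\<lambda>a. c * t a) \<in> real_homs G"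
  by (simp add: real_homs_def algebra_simps)

lemma real_homs_diff_scale:
  "t \<in> real_homs G \<Longrightarrow> s \<in> real_homs G \<Longrightarrow> (\<lambda>a. t a - c * s a) \<in> real_homs G"
  by (simp add: real_homs_def algebra_simps)

section \<open>Integer combinations and the values of real-valued homomorphisms on them\<close>

context comm_group
begin

lemma real_hom_one: "t \<in> real_homs G \<Longrightarrow> t \<one> = 0"
  using real_homsD[of t G \<one> \<one>] by simp

lemma real_hom_inv: "t \<in> real_homs G \<Longrightarrow> x \<in> carrier G \<Longrightarrow> t (inv x) = - t x"
  using real_homsD[of t G x "inv x"] by (simp add: real_hom_one)

lemma real_hom_nat_pow: "t \<in> real_homs G \<Longrightarrow> x \<in> carrier G \<Longrightarrow> t (x [^] (n::nat)) = real n * t x"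
  by (induction n) (auto simp: real_hom_one real_homsD algebra_simps)

lemma real_hom_int_pow: "t \<in> real_homs G \<Longrightarrow> x \<in> carrier G \<Longrightarrow> t (x [^] (z::int)) = of_int z * t x"
  by (cases z rule: int_cases2) (auto simp: int_pow_neg int_pow_int real_hom_nat_pow real_hom_inv)

lemma lincomb_closed: "(\<And>i. i < m \<Longrightarrow> b i \<in> carrier G) \<Longrightarrow> lincomb G b m c \<in> carrier G"
  unfolding lincomb_def by (rule finprod_closed) auto

lemma lincomb_Suc:
  "(\<And>i. i \<le> m \<Longrightarrow> b i \<in> carrier G) \<Longrightarrow> lincomb G b (Suc m) c = b m [^] c m \<otimes> lincomb G b m c"
  unfolding lincomb_def lessThan_Suc by (subst finprod_insert) auto

lemma lincomb_0 [simp]: "lincomb G b 0 c = \<one>"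
  by (simp add: lincomb_def)

lemma lincomb_cong:
  assumes "\<And>i. i < m \<Longrightarrow> b i \<in> carrier G" "\<And>i. i < m \<Longrightarrow> b i = b' i" "\<And>i. i < m \<Longrightarrow> c i = c' i"
  shows "lincomb G b m c = lincomb G b' m c'"
  unfolding lincomb_def by (rule finprod_cong') (use assms in auto)

lemma lincomb_zero: "(\<And>i. i < m \<Longrightarrow> c i = 0) \<Longrightarrow> lincomb G b m c = \<one>"
  unfolding lincomb_def by (rule finprod_one_eqI) auto

lemma lincomb_add:
  assumes "\<And>i. i < m \<Longrightarrow> b i \<in> carrier G"
  shows "lincomb G b m (\<lambda>i. c i + d i) = lincomb G b m c \<otimes> lincomb G b m d"
proof -
  have "lincomb G b m (\<lambda>i. c i + d i) = finprod G (\<lambda>i. b i [^] c i \<otimes> b i [^] d i) {..<m}"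
    unfolding lincomb_def by (rule finprod_cong') (use assms in \<open>auto simp: int_pow_mult\<close>)
  also have "\<dots> = lincomb G b m c \<otimes> lincomb G b m d"
    unfolding lincomb_def by (rule finprod_multf) (use assms in auto)
  finally show ?thesis .
qed

lemma lincomb_inv:
  assumes "\<And>i. i < m \<Longrightarrow> b i \<in> carrier G"
  shows "lincomb G b m (\<lambda>i. - c i) = inv (lincomb G b m c)"
proof -
  have "lincomb G b m (\<lambda>i. - c i) \<otimes> lincomb G b m c = \<one>"
    using lincomb_add[OF assms, where c = "\<lambda>i. - c i" and d = c] by (simp add: lincomb_zero)
  then show ?thesis using assms lincomb_closed by (metis inv_equality)
qed

lemma lincomb_unit:
  assumes "\<And>i. i < m \<Longrightarrow> b i \<in> carrier G" "j < m"
  shows "lincomb G b m (\<lambda>i. if i = j then 1 else 0) = b j"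
proof -
  have "lincomb G b m (\<lambda>i. if i = j then 1 else 0) = (\<Otimes>i\<in>{..<m}. if j = i then b i else \<one>)"
    unfolding lincomb_def by (rule finprod_cong') (use assms in auto)
  also have "\<dots> = b j"
    by (rule finprod_singleton) (use assms in auto)
  finally show ?thesis .
qed

lemma lincomb_hom:
  assumes "\<And>i. i < m \<Longrightarrow> b i \<in> carrier G" "\<And>x y. x \<in> carrier G \<Longrightarrow> y \<in> carrier G \<Longrightarrow> \<gamma> (x \<otimes> y) = \<gamma> x * (\<gamma> y :: complex)"
    "\<And>x. x \<in> carrier G \<Longrightarrow> \<gamma> x \<noteq> 0"
  shows "\<gamma> (lincomb G b m c) = (\<Prod>i<m. \<gamma> (b i) powi c i)"
proof -
  have one: "\<gamma> \<one> = 1" using assms(2)[of \<one> \<one>] assms(3)[of \<one>] by simp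
  have nat: "\<gamma> (x [^] (n::nat)) = \<gamma> x ^ n" if "x \<in> carrier G" for x n
    using that by (induction n) (auto simp: one assms(2))
  have inv: "\<gamma> (inv x) = inverse (\<gamma> x)" if "x \<in> carrier G" for x
    using assms(2)[of x "inv x"] assms(3)[of x] that one by (simp add: field_simps)
  have int: "\<gamma> (x [^] z) = \<gamma> x powi z" if "x \<in> carrier G" for x and z :: int
    using that by (cases z rule: int_cases2) (auto simp: int_pow_neg int_pow_int nat inv power_int_minus)
  show ?thesis using assms(1)
  proof (induction m)
    case 0
    then show ?case by (simp add: one)
  next
    case (Suc m)
    have "\<gamma> (lincomb G b (Suc m) c) = \<gamma> (b m [^] c m) * \<gamma> (lincomb G b m c)"
      using Suc.prems by (subst lincomb_Suc) (auto intro!: assms(2) lincomb_closed)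
    then show ?case using Suc by (simp add: int)
  qed
qed

lemma real_hom_lincomb:
  assumes "t \<in> real_homs G" "\<And>i. i < m \<Longrightarrow> b i \<in> carrier G"
  shows "t (lincomb G b m c) = (\<Sum>i<m. of_int (c i) * t (b i))"
  using assms(2)
proof (induction m)
  case 0
  then show ?case by (simp add: real_hom_one assms)
next
  case (Suc m)
  have "t (lincomb G b (Suc m) c) = t (b m [^] c m) + t (lincomb G b m c)"
    using Suc.prems by (subst lincomb_Suc) (auto intro!: real_homsD[OF assms(1)] lincomb_closed)
  then show ?case using Suc assms(1) by (simp add: real_hom_int_pow)
qed

lemma dual_family_lincomb:
  assumes "dual_family G b t m" "i < m"
  shows "t i (lincomb G b m c) = of_int (c i)"
proof -
  have "t i (lincomb G b m c) = (\<Sum>j<m. of_int (c j) * (if i = j then 1 else 0))"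
    using assms by (subst real_hom_lincomb) (auto simp: dual_family_def intro!: sum.cong)
  also have "\<dots> = of_int (c i)"
    using assms(2) by (simp add: if_distrib cong: if_cong)
  finally show ?thesis .
qed

lemma subgroup_range_lincomb:
  assumes "\<And>i. i < m \<Longrightarrow> b i \<in> carrier G"
  shows "subgroup (range (lincomb G b m)) G"
proof
  show "range (lincomb G b m) \<subseteq> carrier G" using lincomb_closed[OF assms] by auto
  show "\<one> \<in> range (lincomb G b m)" by (rule range_eqI[of _ _ "\<lambda>_. 0"]) (simp add: lincomb_zero)
  show "x \<otimes> y \<in> range (lincomb G b m)" if "x \<in> range (lincomb G b m)" "y \<in> range (lincomb G b m)" for x y
    using that by (auto simp flip: lincomb_add[OF assms])
  show "inv x \<in> range (lincomb G b m)" if "x \<in> range (lincomb G b m)" for x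
    using that by (auto simp flip: lincomb_inv[OF assms])
qed

section \<open>Separating an element from a subgroup by a real-valued homomorphism\<close>

lemma int_pow_notin:
  assumes "subgroup M G" "x \<in> carrier G" "\<And>k::nat. k > 0 \<Longrightarrow> x [^] k \<notin> M" "x [^] (z::int) \<in> M"
  shows "z = 0"
proof (rule ccontr)
  assume "z \<noteq> 0"
  show False
  proof (cases z rule: int_cases2)
    case (nonneg n)
    then show ?thesis using assms(3)[of n] assms(4) \<open>z \<noteq> 0\<close> by (simp add: int_pow_int)
  next
    case (nonpos n)
    then have "inv (x [^] n) \<in> M" using assms by (simp add: int_pow_neg int_pow_int)
    then have "x [^] n \<in> M"
      using subgroup.m_inv_closed[OF assms(1)] assms(2) by (metis inv_inv nat_pow_closed)
    then show ?thesis using assms(3)[of n] \<open>z \<noteq> 0\<close> nonpos by simp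
  qed
qed

lemma subgroup_adjoin:
  assumes "subgroup M G" "y \<in> carrier G"
  shows "subgroup {\<mu> \<otimes> y [^] (j::int) | \<mu> j. \<mu> \<in> M} G"
proof
  have M: "\<mu> \<in> carrier G" if "\<mu> \<in> M" for \<mu> using subgroup.mem_carrier[OF assms(1) that] .
  show "{\<mu> \<otimes> y [^] (j::int) | \<mu> j. \<mu> \<in> M} \<subseteq> carrier G" using M assms by auto
  show "\<one> \<in> {\<mu> \<otimes> y [^] (j::int) | \<mu> j. \<mu> \<in> M}"
    using subgroup.one_closed[OF assms(1)] by (auto intro!: exI[of _ \<one>] exI[of _ "0::int"])
  fix u assume "u \<in> {\<mu> \<otimes> y [^] (j::int) | \<mu> j. \<mu> \<in> M}"
  then obtain \<mu> j where u: "u = \<mu> \<otimes> y [^] (j::int)" "\<mu> \<in> M" by auto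
  have "inv u = inv \<mu> \<otimes> y [^] (-j)"
    using u M assms by (simp add: inv_mult int_pow_neg)
  then show "inv u \<in> {\<mu> \<otimes> y [^] (j::int) | \<mu> j. \<mu> \<in> M}"
    using subgroup.m_inv_closed[OF assms(1) u(2)] by auto
  fix v assume "v \<in> {\<mu> \<otimes> y [^] (j::int) | \<mu> j. \<mu> \<in> M}"
  then obtain \<nu> k where v: "v = \<nu> \<otimes> y [^] (k::int)" "\<nu> \<in> M" by auto
  have "u \<otimes> v = (\<mu> \<otimes> \<nu>) \<otimes> y [^] (j + k)"
    using u v M assms by (simp add: int_pow_mult m_ac)
  then show "u \<otimes> v \<in> {\<mu> \<otimes> y [^] (j::int) | \<mu> j. \<mu> \<in> M}"
    using subgroup.m_closed[OF assms(1) u(2) v(2)] by blast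
qed

text \<open>Avoiding the positive powers of \<open>x\<close> survives unions of chains, so Zorn's
  lemma applies. Maximality makes the quotient by \<open>M\<close> as small as possible: up to
  torsion it is rationally generated by \<open>x\<close>.\<close>

lemma maximal_subgroup_avoiding_powers:
  assumes "subgroup H G" "\<And>k::nat. k > 0 \<Longrightarrow> x [^] k \<notin> H"
  shows "\<exists>M. subgroup M G \<and> H \<subseteq> M \<and> (\<forall>k::nat. k > 0 \<longrightarrow> x [^] k \<notin> M) \<and>
    (\<forall>K. subgroup K G \<longrightarrow> M \<subseteq> K \<longrightarrow> (\<forall>k::nat. k > 0 \<longrightarrow> x [^] k \<notin> K) \<longrightarrow> K = M)"
proof -
  define \<A> where "\<A> = {K. subgroup K G \<and> H \<subseteq> K \<and> (\<forall>k::nat. k > 0 \<longrightarrow> x [^] k \<notin> K)}"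
  have "\<exists>M\<in>\<A>. \<forall>X\<in>\<A>. M \<subseteq> X \<longrightarrow> X = M"
  proof (rule subset_Zorn_nonempty)
    show "\<A> \<noteq> {}" using assms by (auto simp: \<A>_def)
    fix \<C> assume C: "\<C> \<noteq> {}" "subset.chain \<A> \<C>"
    then have sub: "K \<in> \<C> \<Longrightarrow> K \<in> \<A>" for K by (auto simp: subset.chain_def)
    have ch: "K \<in> \<C> \<Longrightarrow> L \<in> \<C> \<Longrightarrow> K \<subseteq> L \<or> L \<subseteq> K" for K L
      using C(2) by (auto simp: subset.chain_def)
    have "subgroup (\<Union>\<C>) G"
    proof
      show "\<Union>\<C> \<subseteq> carrier G" using sub subgroup.subset by (fastforce simp: \<A>_def)
      show "\<one> \<in> \<Union>\<C>" using C(1) sub subgroup.one_closed by (fastforce simp: \<A>_def)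
      show "inv u \<in> \<Union>\<C>" if "u \<in> \<Union>\<C>" for u
        using that sub subgroup.m_inv_closed by (fastforce simp: \<A>_def)
      show "u \<otimes> v \<in> \<Union>\<C>" if "u \<in> \<Union>\<C>" "v \<in> \<Union>\<C>" for u v
      proof -
        obtain K where K: "u \<in> K" "K \<in> \<C>" using \<open>u \<in> \<Union>\<C>\<close> by (rule UnionE)
        obtain L where L: "v \<in> L" "L \<in> \<C>" using \<open>v \<in> \<Union>\<C>\<close> by (rule UnionE)
        obtain N where "u \<in> N" "v \<in> N" "N \<in> \<C>" using ch[OF K(2) L(2)] K L by blast
        then show ?thesis using sub[of N] subgroup.m_closed[of N G u v] by (auto simp: \<A>_def)
      qed
    qed
    then show "\<Union>\<C> \<in> \<A>" using C(1) sub by (fastforce simp: \<A>_def)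
  qed
  then obtain M where M: "M \<in> \<A>" "\<And>X. X \<in> \<A> \<Longrightarrow> M \<subseteq> X \<Longrightarrow> X = M" by blast
  moreover have "K \<in> \<A>" if "subgroup K G" "M \<subseteq> K" "\<forall>k::nat. k > 0 \<longrightarrow> x [^] k \<notin> K" for K
    using that M(1) by (auto simp: \<A>_def)
  ultimately show ?thesis by (intro exI[of _ M]) (auto simp: \<A>_def)
qed

text \<open>Once \<open>H\<close> is enlarged to a maximal subgroup \<open>M\<close> without positive powers of \<open>x\<close>, every \<open>y\<close> has a
  positive power in \<open>M \<langle>x\<rangle>\<close>; the ratio of the two exponents is the value at \<open>y\<close>.\<close>

lemma real_hom_separating:
  assumes H: "subgroup H G" and x: "x \<in> carrier G" and nH: "\<And>k::nat. k > 0 \<Longrightarrow> x [^] k \<notin> H"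
  shows "\<exists>t\<in>real_homs G. (\<forall>h\<in>H. t h = 0) \<and> t x = 1"
proof -
  obtain M where M: "subgroup M G" "H \<subseteq> M" and nM: "\<And>k::nat. k > 0 \<Longrightarrow> x [^] k \<notin> M"
    and max: "\<And>K. subgroup K G \<Longrightarrow> M \<subseteq> K \<Longrightarrow> \<forall>k::nat. k > 0 \<longrightarrow> x [^] k \<notin> K \<Longrightarrow> K = M"
    using maximal_subgroup_avoiding_powers[OF H nH] by blast
  have Mc: "\<mu> \<in> carrier G" if "\<mu> \<in> M" for \<mu> using subgroup.mem_carrier[OF M(1) that] .
  define R where "R y k m \<longleftrightarrow> k > 0 \<and> (\<exists>\<mu>\<in>M. y [^] (k::int) = \<mu> \<otimes> x [^] (m::int))" for y k m
  have ex: "\<exists>k m. R y k m" if y: "y \<in> carrier G" for y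
  proof (cases "y \<in> M")
    case True
    then have "R y 1 0" using y by (auto simp: R_def intro!: bexI[of _ y])
    then show ?thesis by blast
  next
    case False
    \<comment> \<open>Adjoining y strictly enlarges M, so by maximality a positive power of x
      appears. The exponent j of y in it is nonzero, since no such power lies in M. The sign of j
      decides how the relation is solved for y, because \<open>R\<close> asks for a positive
      exponent of y.\<close>
    define K where "K = {\<mu> \<otimes> y [^] (j::int) | \<mu> j. \<mu> \<in> M}"
    have "\<one> \<otimes> y [^] (1::int) \<in> K"
      unfolding K_def using subgroup.one_closed[OF M(1)] by blast
    then have "y \<in> K" using y by simp
    moreover have "M \<subseteq> K"
    proof
      fix \<mu> assume "\<mu> \<in> M"
      then have "\<mu> \<otimes> y [^] (0::int) \<in> K" unfolding K_def by blast
      then show "\<mu> \<in> K" using Mc \<open>\<mu> \<in> M\<close> by simp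
    qed
    ultimately obtain k :: nat where k: "k > 0" "x [^] k \<in> K"
      using max[of K] False subgroup_adjoin[OF M(1) y] unfolding K_def by blast
    then obtain \<mu> j where j: "x [^] k = \<mu> \<otimes> y [^] (j::int)" "\<mu> \<in> M" unfolding K_def by auto
    have "j \<noteq> 0" using j nM[OF k(1)] Mc by auto
    have xk: "x [^] int k = \<mu> \<otimes> y [^] j" using j by (simp add: int_pow_int)
    show ?thesis
    proof (cases "j > 0")
      case True
      have "y [^] j = inv \<mu> \<otimes> x [^] int k"
        unfolding xk using Mc j(2) y by (simp add: inv_solve_left m_assoc[symmetric])
      then have "R y j (int k)" using True subgroup.m_inv_closed[OF M(1) j(2)] by (auto simp: R_def)
      then show ?thesis by blast
    next
      case False
      have "y [^] (-j) = \<mu> \<otimes> x [^] (- int k)"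
        unfolding int_pow_neg[OF x] xk using Mc j(2) y
        by (simp add: inv_mult m_assoc[symmetric] int_pow_neg)
      then have "R y (-j) (- int k)" using False \<open>j \<noteq> 0\<close> j(2) by (auto simp: R_def)
      then show ?thesis by blast
    qed
  qed
  have mult: "R (y \<otimes> z) (k * l) (m * l + n * k)" if "R y k m" "R z l n" "y \<in> carrier G" "z \<in> carrier G" for y z k l m n
  proof -
    obtain \<mu> \<nu> where 1: "y [^] k = \<mu> \<otimes> x [^] m" "z [^] l = \<nu> \<otimes> x [^] n" "\<mu> \<in> M" "\<nu> \<in> M"
      using \<open>R y k m\<close> \<open>R z l n\<close> by (auto simp: R_def)
    have "(y \<otimes> z) [^] (k * l) = (y [^] k) [^] l \<otimes> (z [^] l) [^] k"
      using that by (simp add: int_pow_distrib int_pow_pow mult.commute)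
    also have "\<dots> = (\<mu> [^] l \<otimes> \<nu> [^] k) \<otimes> x [^] (m * l + n * k)"
      using 1 Mc x by (simp add: int_pow_distrib int_pow_pow int_pow_mult m_ac)
    finally have "(y \<otimes> z) [^] (k * l) = (\<mu> [^] l \<otimes> \<nu> [^] k) \<otimes> x [^] (m * l + n * k)" .
    moreover have "\<mu> [^] l \<otimes> \<nu> [^] k \<in> M"
      using 1 subgroup.m_closed[OF M(1)] subgroup_int_pow_closed[OF M(1)] by blast
    moreover have "k * l > 0" using \<open>R y k m\<close> \<open>R z l n\<close> by (auto simp: R_def)
    ultimately show ?thesis by (auto simp: R_def)
  qed
  \<comment> \<open>Raising the two relations to the powers l and k and comparing them puts x to the
    power m l - n k into M, which forces this exponent to be 0.\<close>
  have uniq: "real_of_int m / of_int k = of_int n / of_int l" if "R y k m" "R y l n" "y \<in> carrier G" for y k l m n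
  proof -
    obtain \<mu> \<nu> where 1: "y [^] k = \<mu> \<otimes> x [^] m" "y [^] l = \<nu> \<otimes> x [^] n" "\<mu> \<in> M" "\<nu> \<in> M" "k > 0" "l > 0"
      using \<open>R y k m\<close> \<open>R y l n\<close> by (auto simp: R_def)
    have "\<mu> [^] l \<otimes> x [^] (m * l) = (y [^] k) [^] l"
      using 1 Mc x by (simp add: int_pow_distrib int_pow_pow)
    also have "\<dots> = (y [^] l) [^] k" using that by (simp add: int_pow_pow mult.commute)
    also have "\<dots> = \<nu> [^] k \<otimes> x [^] (n * k)"
      using 1 Mc x by (simp add: int_pow_distrib int_pow_pow)
    finally have e: "\<mu> [^] l \<otimes> x [^] (m * l) = \<nu> [^] k \<otimes> x [^] (n * k)" .
    have "x [^] (m * l - n * k) = inv (\<mu> [^] l) \<otimes> (\<mu> [^] l \<otimes> x [^] (m * l)) \<otimes> inv (x [^] (n * k))"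
      using 1 Mc x by (simp add: int_pow_diff m_assoc[symmetric])
    also have "\<dots> = inv (\<mu> [^] l) \<otimes> \<nu> [^] k"
      unfolding e using 1 Mc x by (simp add: m_assoc)
    finally have "x [^] (m * l - n * k) \<in> M"
      using 1 subgroup.m_closed[OF M(1)] subgroup.m_inv_closed[OF M(1)] subgroup_int_pow_closed[OF M(1)] by metis
    then have "m * l - n * k = 0" using int_pow_notin[OF M(1) x nM] by blast
    then have "real_of_int m * of_int l = of_int n * of_int k"
      by (metis eq_iff_diff_eq_0 of_int_mult)
    then show ?thesis using 1 by (simp add: field_simps)
  qed
  define t where "t y = (SOME q. \<exists>k m. R y k m \<and> q = real_of_int m / of_int k)" for y
  have t: "t y = real_of_int m / of_int k" if "R y k m" "y \<in> carrier G" for y k m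
  proof -
    have "\<exists>k m. R y k m \<and> t y = real_of_int m / of_int k"
      unfolding t_def by (rule someI_ex) (use that in blast)
    then show ?thesis using uniq that by metis
  qed
  show ?thesis
  proof (intro bexI[of _ t] conjI ballI)
    show "t h = 0" if "h \<in> H" for h
    proof -
      have "R h 1 0" using that M(2) Mc by (auto simp: R_def intro!: bexI[of _ h])
      then show ?thesis using t[of h 1 0] that M(2) Mc by auto
    qed
    have "R x 1 1" using x subgroup.one_closed[OF M(1)] by (auto simp: R_def intro!: bexI[of _ \<one>])
    then show "t x = 1" using t[of x 1 1] x by auto
    show "t \<in> real_homs G"
      unfolding real_homs_def
    proof (intro CollectI ballI)
      fix y z assume yz: "y \<in> carrier G" "z \<in> carrier G"
      obtain k m l n where R: "R y k m" "R z l n" using ex yz by metis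
      then have "k > 0" "l > 0" by (auto simp: R_def)
      have "t (y \<otimes> z) = (of_int m * of_int l + of_int n * of_int k) / (of_int k * of_int l)"
        using t[OF mult[OF R yz]] yz by simp
      also have "\<dots> = of_int m / of_int k + of_int n / of_int l"
        using \<open>k > 0\<close> \<open>l > 0\<close> by (simp add: add_frac_eq)
      finally show "t (y \<otimes> z) = t y + t z"
        using t[OF R(1) yz(1)] t[OF R(2) yz(2)] by simp
    qed
  qed
qed

section \<open>Dual families and bases of finitely generated subgroups\<close>

lemma dual_family_extend:
  assumes d: "dual_family G b t m" and s: "s \<in> carrier G" and ns: "\<And>k::nat. k > 0 \<Longrightarrow> s [^] k \<notin> range (lincomb G b m)"
  shows "\<exists>t'. dual_family G (b(m := s)) t' (Suc m)"
proof -
  have b: "b i \<in> carrier G" "t i \<in> real_homs G" if "i < m" for i using d that by (auto simp: dual_family_def)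
  obtain u where u: "u \<in> real_homs G" "\<And>h. h \<in> range (lincomb G b m) \<Longrightarrow> u h = 0" "u s = 1"
    using real_hom_separating[OF subgroup_range_lincomb[OF b(1)] s ns] by blast
  have ub: "u (b i) = 0" if "i < m" for i
  proof -
    have "b i \<in> range (lincomb G b m)" using lincomb_unit[of m b i, OF b(1) that] by (intro range_eqI) (rule sym)
    then show ?thesis using u(2) by simp
  qed
  \<comment> \<open>As in Gram-Schmidt, subtracting \<open>t i s\<close> times \<open>u\<close>
    makes the old functionals vanish at \<open>s\<close>; their values on the old elements survive
    because \<open>u\<close> is 0 there.\<close>
  define t' where "t' i = (if i < m then (\<lambda>a. t i a - t i s * u a) else u)" for i
  have "dual_family G (b(m := s)) t' (Suc m)"
    using d s u(1,3) ub by (auto simp: dual_family_def t'_def less_Suc_eq intro!: real_homs_diff_scale)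
  then show ?thesis by blast
qed

text \<open>Independence over the integers keeps every positive power of the next element out of the
  span of its predecessors, which is what \<open>dual_family_extend\<close> requires.\<close>

lemma dual_family_of_independent:
  assumes "\<And>i. i < m \<Longrightarrow> b i \<in> carrier G"
    and "\<And>c. lincomb G b m c = \<one> \<Longrightarrow> \<forall>i<m. c i = 0"
  shows "\<exists>t. dual_family G b t m"
  using assms
proof (induction m)
  case 0
  then show ?case by (auto simp: dual_family_def)
next
  case (Suc m)
  have lin: "lincomb G b (Suc m) (c(m := z)) = b m [^] z \<otimes> lincomb G b m c" for c z
    using Suc.prems(1) lincomb_cong[of m b b "c(m := z)" c] by (subst lincomb_Suc) auto
  have ind: "\<forall>i<m. c i = 0" if "lincomb G b m c = \<one>" for c
  proof -
    have "lincomb G b (Suc m) (c(m := 0)) = \<one>" using that Suc.prems(1) unfolding lin by simp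
    then show ?thesis using Suc.prems(2) by (metis fun_upd_other less_SucI less_irrefl_nat)
  qed
  then obtain t where t: "dual_family G b t m" using Suc by force
  have "b m [^] k \<notin> range (lincomb G b m)" if "k > 0" for k :: nat
  proof
    assume "b m [^] k \<in> range (lincomb G b m)"
    then obtain c where c: "b m [^] k = lincomb G b m c" by auto
    have "lincomb G b (Suc m) (c(m := - int k)) = \<one>"
      using Suc.prems(1) lincomb_closed[of m b] unfolding lin by (simp add: int_pow_neg int_pow_int c)
    then show False using Suc.prems(2) that by fastforce
  qed
  then obtain t' where "dual_family G (b(m := b m)) t' (Suc m)"
    using dual_family_extend[OF t, of "b m"] Suc.prems(1) by auto
  then show ?case by auto
qed

text \<open>Greedy choice of a maximal independent part of \<open>S\<close>: an element is adjoined
  only if none of its positive powers is in the span so far. This captures \<open>S\<close> only up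
  to powers; \<open>free_basis\<close> later repairs that.\<close>

lemma dual_family_rational_span:
  assumes "finite S" "S \<subseteq> carrier G"
  shows "\<exists>m b t. dual_family G b t m \<and> (\<forall>s\<in>S. \<exists>k::nat. k > 0 \<and> s [^] k \<in> range (lincomb G b m))"
  using assms
proof (induction S)
  case empty
  have "dual_family G (\<lambda>_. \<one>) (\<lambda>_ _. 0) 0" by (simp add: dual_family_def)
  then show ?case by blast
next
  case (insert s S)
  then obtain m b t where d: "dual_family G b t m"
    and S: "\<forall>s\<in>S. \<exists>k::nat. k > 0 \<and> s [^] k \<in> range (lincomb G b m)" by auto
  show ?case
  proof (cases "\<exists>k::nat. k > 0 \<and> s [^] k \<in> range (lincomb G b m)")
    case True
    then show ?thesis using d S by blast
  next
    case False
    then obtain t' where t': "dual_family G (b(m := s)) t' (Suc m)"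
      using dual_family_extend[OF d, of s] insert.prems by blast
    have b: "i < m \<Longrightarrow> b i \<in> carrier G" for i using d by (auto simp: dual_family_def)
    have lin: "lincomb G (b(m := s)) (Suc m) (c(m := z)) = s [^] z \<otimes> lincomb G b m c" for c z
      using b insert.prems lincomb_cong[of m "b(m := s)" b "c(m := z)" c] by (subst lincomb_Suc) auto
    have "lincomb G b m c \<in> range (lincomb G (b(m := s)) (Suc m))" for c
    proof -
      have "lincomb G (b(m := s)) (Suc m) (c(m := 0)) = lincomb G b m c"
        using lin[of c 0] lincomb_closed[OF b, of m] insert.prems by simp
      then show ?thesis by (intro range_eqI) (rule sym)
    qed
    then have "\<forall>s'\<in>S. \<exists>k::nat. k > 0 \<and> s' [^] k \<in> range (lincomb G (b(m := s)) (Suc m))"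
      using S by fastforce
    moreover have "s [^] (1::nat) \<in> range (lincomb G (b(m := s)) (Suc m))"
    proof -
      have "lincomb G (b(m := s)) (Suc m) ((\<lambda>_. 0)(m := 1)) = s [^] (1::nat)"
        using lin[of "\<lambda>_. 0" 1] lincomb_zero[of m "\<lambda>_. 0" b] insert.prems by simp
      then show ?thesis by (intro range_eqI) (rule sym)
    qed
    ultimately have "\<forall>s'\<in>insert s S. \<exists>k::nat. k > 0 \<and> s' [^] k \<in> range (lincomb G (b(m := s)) (Suc m))"
      by (metis insert_iff zero_less_one)
    then show ?thesis using t' by blast
  qed
qed

text \<open>The functionals embed \<open>H\<close> in a lattice of rank \<open>r\<close>, so this is
  freeness of subgroups of such a lattice, by induction on \<open>r\<close>. The last functional
  maps \<open>H\<close> onto the multiples of some c, and an element of value c splits off from its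
  kernel. The dual functionals are carried along so that they stay defined on all of
  \<open>G\<close>.\<close>

lemma free_basis:
  fixes r :: nat
  assumes "subgroup H G" "\<And>i. i < r \<Longrightarrow> t i \<in> real_homs G"
    and "\<And>i x. i < r \<Longrightarrow> x \<in> H \<Longrightarrow> t i x \<in> \<int>"
    and "\<And>x. x \<in> H \<Longrightarrow> \<forall>i<r. t i x = 0 \<Longrightarrow> x = \<one>"
  shows "\<exists>m b u. dual_family G b u m \<and> (\<forall>i<m. b i \<in> H) \<and> H \<subseteq> range (lincomb G b m)"
  using assms
proof (induction r arbitrary: H)
  case 0
  have "dual_family G (\<lambda>_. \<one>) (\<lambda>_ _. 0) 0" by (simp add: dual_family_def)
  moreover have "H \<subseteq> range (lincomb G (\<lambda>_. \<one>) 0)" using 0 by auto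
  ultimately show ?case by blast
next
  case (Suc r)
  have Hc: "x \<in> carrier G" if "x \<in> H" for x using subgroup.mem_carrier[OF Suc.prems(1) that] .
  have tr: "t r \<in> real_homs G" using Suc.prems(2) by simp
  show ?case
  proof (cases "\<forall>x\<in>H. t r x = 0")
    case True
    then have "x = \<one>" if "x \<in> H" "\<forall>i<r. t i x = 0" for x
      using Suc.prems(4)[of x] that by (auto simp: less_Suc_eq)
    then show ?thesis using Suc.IH[OF Suc.prems(1)] Suc.prems(2,3) by simp
  next
    case False
    define P where "P n \<longleftrightarrow> n > 0 \<and> (\<exists>v\<in>H. t r v = real n)" for n :: nat
    have "\<exists>n. P n"
    proof -
      obtain x where x: "x \<in> H" "t r x \<noteq> 0" using False by auto
      obtain z where z: "t r x = of_int z" using Suc.prems(3)[of r x] x by (auto elim: Ints_cases)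
      show ?thesis
      proof (cases "z > 0")
        case True
        then have "P (nat z)" using x z by (auto simp: P_def)
        then show ?thesis by blast
      next
        case False
        have "inv x \<in> H" "t r (inv x) = real (nat (- z))"
          using x z False subgroup.m_inv_closed[OF Suc.prems(1)] Hc real_hom_inv[OF tr] by auto
        then have "P (nat (- z))" using x z False by (auto simp: P_def)
        then show ?thesis by blast
      qed
    qed
    then obtain c where c: "P c" "\<And>n. P n \<Longrightarrow> c \<le> n" by (metis LeastI Least_le)
    then obtain v where v: "v \<in> H" "t r v = real c" "c > 0" by (auto simp: P_def)
    define H' where "H' = {x\<in>H. t r x = 0}"
    \<comment> \<open>Division with remainder: the remainder is again a value of \<open>t r\<close>
      on H, so minimality of c makes it 0. Hence every element of H is a power of v times an element
      of the kernel H'.\<close>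
    have red: "\<exists>q::int. v [^] (- q) \<otimes> x \<in> H'" if x: "x \<in> H" for x
    proof -
      obtain z where z: "t r x = of_int z" using Suc.prems(3)[of r x] x by (auto elim: Ints_cases)
      define y where "y = v [^] (- (z div int c)) \<otimes> x"
      have yH: "y \<in> H"
        unfolding y_def using x v Suc.prems(1) by (intro subgroup.m_closed subgroup_int_pow_closed) auto
      have "t r y = of_int (- (z div int c)) * t r v + t r x"
        unfolding y_def using x v Hc by (subst real_homsD[OF tr]) (auto simp: real_hom_int_pow[OF tr])
      also have "\<dots> = of_int (z - (z div int c) * int c)"
        by (simp add: z v)
      also have "z - (z div int c) * int c = z mod int c" by (simp add: minus_div_mult_eq_mod)
      finally have ty: "t r y = of_int (z mod int c)" .
      have "z mod int c = 0"
      proof (rule ccontr)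
        assume "z mod int c \<noteq> 0"
        then have "z mod int c > 0" using v(3) by (simp add: order.not_eq_order_implies_strict)
        then have "P (nat (z mod int c))" using ty yH by (auto simp: P_def)
        then show False using c(2) v(3) by (metis \<open>0 < z mod int c\<close> nat_less_iff not_less of_nat_0_less_iff order_less_imp_le pos_mod_bound)
      qed
      then show ?thesis using yH ty unfolding H'_def y_def by (intro exI[of _ "z div int c"]) auto
    qed
    have H': "subgroup H' G"
    proof
      show "H' \<subseteq> carrier G" using Hc by (auto simp: H'_def)
      show "\<one> \<in> H'" using subgroup.one_closed[OF Suc.prems(1)] by (simp add: H'_def real_hom_one[OF tr])
      show "inv x \<in> H'" if "x \<in> H'" for x
        using that subgroup.m_inv_closed[OF Suc.prems(1)] Hc by (auto simp: H'_def real_hom_inv[OF tr])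
      show "x \<otimes> y \<in> H'" if "x \<in> H'" "y \<in> H'" for x y
        using that subgroup.m_closed[OF Suc.prems(1)] Hc by (auto simp: H'_def real_homsD[OF tr])
    qed
    have "x = \<one>" if "x \<in> H'" "\<forall>i<r. t i x = 0" for x
      using Suc.prems(4)[of x] that by (auto simp: less_Suc_eq H'_def)
    then obtain m b u where d: "dual_family G b u m" and bH: "\<forall>i<m. b i \<in> H'" and sub: "H' \<subseteq> range (lincomb G b m)"
      using Suc.IH[OF H'] Suc.prems(2,3) by (auto simp: H'_def)
    have bc: "b i \<in> carrier G" if "i < m" for i using bH Hc that by (auto simp: H'_def)
    \<comment> \<open>Scaled to be 1 at v, this functional vanishes on H' and plays the part that
      the separating homomorphism has in \<open>dual_family_extend\<close>.\<close>
    define s where "s = (\<lambda>a. (1 / real c) * t r a)"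
    define u' where "u' i = (if i < m then (\<lambda>a. u i a - u i v * s a) else s)" for i
    have s: "s \<in> real_homs G" unfolding s_def using tr by (rule real_homs_scale)
    have sb: "s (b i) = 0" if "i < m" for i using bH that by (auto simp: s_def H'_def)
    have sv: "s v = 1" using v by (simp add: s_def)
    have "dual_family G (b(m := v)) u' (Suc m)"
      using d s sb sv Hc[OF v(1)] by (auto simp: dual_family_def u'_def less_Suc_eq intro!: real_homs_diff_scale)
    moreover have "\<forall>i<Suc m. (b(m := v)) i \<in> H" using bH v by (auto simp: H'_def)
    moreover have "H \<subseteq> range (lincomb G (b(m := v)) (Suc m))"
    proof
      fix x assume x: "x \<in> H"
      obtain q :: int where "v [^] (- q) \<otimes> x \<in> H'" using red[OF x] by blast
      then obtain c' where c': "v [^] (- q) \<otimes> x = lincomb G b m c'" using sub by auto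
      have "lincomb G (b(m := v)) (Suc m) (c'(m := q)) = v [^] q \<otimes> lincomb G b m c'"
        using bc Hc[OF v(1)] lincomb_cong[of m "b(m := v)" b "c'(m := q)" c'] by (subst lincomb_Suc) auto
      also have "\<dots> = x"
        unfolding c'[symmetric] using Hc[OF v(1)] Hc[OF x] by (simp add: m_assoc[symmetric] int_pow_neg)
      finally show "x \<in> range (lincomb G (b(m := v)) (Suc m))" by (intro range_eqI) (rule sym)
    qed
    ultimately show ?thesis by blast
  qed
qed

text \<open>A common exponent N puts all N-th powers of \<open>S\<close> into the span of an
  independent family. On the group H of all elements with that property, N times the old functionals
  are integral, and torsion-freeness makes them jointly injective; so H is free with a basis as in
  \<open>free_basis\<close>.\<close>

lemma dual_family_span:
  assumes tf: "torsion_free G" and S: "finite S" "S \<subseteq> carrier G"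
  shows "\<exists>m b t. dual_family G b t m \<and> S \<subseteq> range (lincomb G b m)"
proof -
  obtain m b t where d: "dual_family G b t m" and "\<forall>s\<in>S. \<exists>k::nat. k > 0 \<and> s [^] k \<in> range (lincomb G b m)"
    using dual_family_rational_span[OF S] by blast
  then obtain k :: "'a \<Rightarrow> nat" where k: "\<And>s. s \<in> S \<Longrightarrow> k s > 0 \<and> s [^] k s \<in> range (lincomb G b m)"
    by metis
  define N where "N = (\<Prod>s\<in>S. k s)"
  have N: "N > 0" using k by (auto simp: N_def intro: prod_pos)
  have b: "b i \<in> carrier G" "t i \<in> real_homs G" if "i < m" for i using d that by (auto simp: dual_family_def)
  note sub = subgroup_range_lincomb[of m b, OF b(1)]
  define H where "H = {x\<in>carrier G. x [^] N \<in> range (lincomb G b m)}"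
  have H: "subgroup H G"
  proof
    show "H \<subseteq> carrier G" by (auto simp: H_def)
    show "\<one> \<in> H" using subgroup.one_closed[OF sub] by (simp add: H_def)
    show "inv x \<in> H" if "x \<in> H" for x
      using that subgroup.m_inv_closed[OF sub] by (auto simp: H_def nat_pow_inv)
    show "x \<otimes> y \<in> H" if "x \<in> H" "y \<in> H" for x y
      using that subgroup.m_closed[OF sub] by (auto simp: H_def nat_pow_distrib)
  qed
  have SH: "S \<subseteq> H"
  proof
    fix s assume s: "s \<in> S"
    then have "N = k s * (\<Prod>s\<in>S - {s}. k s)" unfolding N_def using S(1) by (rule prod.remove[rotated])
    then have "s [^] N = (s [^] k s) [^] int (\<Prod>s\<in>S - {s}. k s)"
      using s S(2) by (subst int_pow_int) (auto simp: nat_pow_pow)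
    moreover have "\<dots> \<in> range (lincomb G b m)"
      using subgroup_int_pow_closed[OF sub] k[OF s] by blast
    ultimately show "s \<in> H" using s S(2) by (auto simp: H_def)
  qed
  have "\<exists>m b u. dual_family G b u m \<and> (\<forall>i<m. b i \<in> H) \<and> H \<subseteq> range (lincomb G b m)"
  proof (rule free_basis[OF H, of m "\<lambda>i a. real N * t i a"])
    show "(\<lambda>a. real N * t i a) \<in> real_homs G" if "i < m" for i using b(2)[OF that] by (rule real_homs_scale)
    have val: "real N * t i x = t i (x [^] N)" if "i < m" "x \<in> H" for i x
      using that b(2) by (subst real_hom_nat_pow) (auto simp: H_def)
    show "real N * t i x \<in> \<int>" if i: "i < m" "x \<in> H" for i x
    proof -
      obtain c where "x [^] N = lincomb G b m c" using i(2) by (auto simp: H_def)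
      then show ?thesis using val[OF i] dual_family_lincomb[OF d i(1)] by simp
    qed
    show "x = \<one>" if "x \<in> H" "\<forall>i<m. real N * t i x = 0" for x
    proof -
      obtain c where c: "x [^] N = lincomb G b m c" using \<open>x \<in> H\<close> by (auto simp: H_def)
      have "c i = 0" if "i < m" for i
        using val[OF that \<open>x \<in> H\<close>] dual_family_lincomb[OF d that, of c] c \<open>\<forall>i<m. real N * t i x = 0\<close> that by simp
      then have "x [^] N = \<one>" using c lincomb_zero by metis
      then show ?thesis using tf N that(1) by (auto simp: torsion_free_def H_def)
    qed
  qed
  then show ?thesis using SH by blast
qed

end

section \<open>Circle-valued functions on tori\<close>

lemma open_coordinate_vimage: "open U \<Longrightarrow> open ((\<lambda>h::'a \<Rightarrow> 'b::topological_space. h a) -` U)"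
  by (simp add: open_vimage)

lemma continuous_on_coordinate: "continuous_on S (\<lambda>f. f i)"
  by (rule continuous_on_subset[OF continuous_on_product_coordinates]) simp

instance "fun" :: (type, t0_space) t0_space
proof
  fix f g :: "'a \<Rightarrow> 'b" assume "f \<noteq> g"
  then obtain a where "f a \<noteq> g a" by auto
  then obtain U where "open U" "\<not> (f a \<in> U \<longleftrightarrow> g a \<in> U)" using separation_t0[of "f a" "g a"] by blast
  then show "\<exists>U. open U \<and> \<not> (f \<in> U \<longleftrightarrow> g \<in> U)"
    using open_coordinate_vimage[of U a] by (intro exI[of _ "(\<lambda>h. h a) -` U"]) auto
qed

instance "fun" :: (type, t1_space) t1_space
proof
  fix f g :: "'a \<Rightarrow> 'b" assume "f \<noteq> g"
  then obtain a where "f a \<noteq> g a" by auto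
  then obtain U where "open U" "f a \<in> U" "g a \<notin> U" by (meson t1_space)
  then show "\<exists>U. open U \<and> f \<in> U \<and> g \<notin> U"
    using open_coordinate_vimage[of U a] by (intro exI[of _ "(\<lambda>h. h a) -` U"]) auto
qed

text \<open>Stone-Weierstrass is later applied on the set of characters, a subset of a function
  type, and asks for a Hausdorff domain.\<close>

instance "fun" :: (type, t2_space) t2_space
proof
  fix f g :: "'a \<Rightarrow> 'b" assume "f \<noteq> g"
  then obtain a where "f a \<noteq> g a" by auto
  then obtain U V where "open U" "open V" "f a \<in> U" "g a \<in> V" "U \<inter> V = {}"
    by (metis hausdorff)
  then show "\<exists>U V. open U \<and> open V \<and> f \<in> U \<and> g \<in> V \<and> U \<inter> V = {}"
    using open_coordinate_vimage[of U a] open_coordinate_vimage[of V a]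
    by (intro exI[of _ "(\<lambda>h. h a) -` U"] exI[of _ "(\<lambda>h. h a) -` V"]) auto
qed

lemma continuous_on_local:
  assumes "\<And>x. x \<in> S \<Longrightarrow> \<exists>U. open U \<and> x \<in> U \<and> continuous_on (S \<inter> U) f"
  shows "continuous_on S f"
  unfolding continuous_on_def
proof
  fix x assume x: "x \<in> S"
  then obtain U where U: "open U" "x \<in> U" "continuous_on (S \<inter> U) f" using assms by blast
  then have "(f \<longlongrightarrow> f x) (at x within (S \<inter> U))" using x by (simp add: continuous_on_def)
  moreover have "at x within (S \<inter> U) = at x within S"
    by (rule at_within_nhd[OF U(2,1)]) auto
  ultimately show "(f \<longlongrightarrow> f x) (at x within S)" by simp
qed

text \<open>A connected image containing two distinct integers would also contain a half-integer.
  Every rigidity step below, for degrees, phases and their invariance, goes through this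
  lemma.\<close>

lemma Ints_valued_constant:
  fixes f :: "'a::topological_space \<Rightarrow> real"
  assumes "connected S" "continuous_on S f" "\<And>x. x \<in> S \<Longrightarrow> f x \<in> \<int>" "x \<in> S" "y \<in> S"
  shows "f x = f y"
proof (rule ccontr)
  assume "f x \<noteq> f y"
  have aux: False if xy: "x \<in> S" "y \<in> S" "f x < f y" for x y
  proof -
    obtain a b where ab: "f x = of_int a" "f y = of_int b" using assms(3) xy by (meson Ints_cases)
    have "a < b" using xy(3) ab by simp
    have "connected (f ` S)" using assms by (intro connected_continuous_image)
    moreover have "f x \<le> f x + 1/2" "f x + 1/2 \<le> f y" using ab \<open>a < b\<close> by auto
    ultimately have "f x + 1/2 \<in> f ` S" using xy by (meson connected_iff_interval imageI)
    then have "f x + 1/2 \<in> \<int>" using assms(3) by auto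
    then have "1/2 \<in> (\<int>::real set)" using ab by (metis Ints_diff Ints_of_int add_diff_cancel_left')
    then show False by (auto elim!: Ints_cases)
  qed
  show False using aux[of x y] aux[of y x] \<open>f x \<noteq> f y\<close> assms by linarith
qed

text \<open>Equality of phases is put as integrality of a quotient so that
  \<open>Ints_valued_constant\<close> applies to it directly.\<close>

lemma cis_eq_cis_iff: "cis a = cis b \<longleftrightarrow> (a - b) / (2 * pi) \<in> \<int>"
proof
  assume "cis a = cis b"
  then have "sin a = sin b \<and> cos a = cos b" by (metis cis.simps)
  then obtain n :: int where "a = b + 2 * pi * n" using sin_cos_eq_iff[of a b] by auto
  then show "(a - b) / (2 * pi) \<in> \<int>" by simp
next
  assume "(a - b) / (2 * pi) \<in> \<int>"
  then obtain n :: int where "(a - b) / (2 * pi) = n" by (auto elim: Ints_cases)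
  then have "a = b + 2 * pi * n" by (simp add: field_simps)
  then have "sin a = sin b \<and> cos a = cos b" using sin_cos_eq_iff[of a b] by auto
  then show "cis a = cis b" by (simp add: complex_eq_iff)
qed

section \<open>Lifting circle-valued maps and their degrees\<close>

lemma cis_Im_Ln:
  assumes "norm z = 1"
  shows "cis (Im (Ln z)) = z"
proof -
  have "z \<noteq> 0" using assms by auto
  then have "Re (Ln z) = 0" "exp (Ln z) = z" using assms by simp_all
  then show ?thesis by (simp add: exp_eq_polar)
qed

lemma cis_sum: "finite I \<Longrightarrow> cis (\<Sum>i\<in>I. f i) = (\<Prod>i\<in>I. cis (f i))"
  by (induction I rule: finite_induct) (auto simp flip: cis_mult)

lemma continuous_on_cis_comp: "continuous_on S f \<Longrightarrow> continuous_on S (\<lambda>x. cis (f x))"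
  unfolding cis_conv_exp by (intro continuous_intros)

text \<open>The library lifts circle-valued maps only on normed spaces, so the first \<open>r\<close> coordinates are
  embedded into the bounded functions on \<open>nat\<close>.\<close>

lemma continuous_circle_lift:
  fixes F :: "(nat \<Rightarrow> real) \<Rightarrow> complex"
  assumes cont: "continuous_on UNIV F" and norm: "\<And>x. norm (F x) = 1"
    and dep: "\<And>x y. \<forall>i<r. x i = y i \<Longrightarrow> F x = F y"
  shows "\<exists>h. continuous_on UNIV h \<and> (\<forall>x. F x = cis (h x)) \<and> (\<forall>x y. (\<forall>i<r. x i = y i) \<longrightarrow> h x = h y)"
proof -
  define e :: "nat \<Rightarrow> nat \<Rightarrow>\<^sub>C real" where "e i = Bcontfun (\<lambda>j. if j = i then 1 else 0)" for i
  have e: "apply_bcontfun (e i) j = (if j = i then 1 else 0)" for i j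
  proof -
    have "(\<lambda>j. if j = i then 1 else 0 :: real) \<in> bcontfun"
      by (rule bcontfun_normI[where b = 1]) (auto intro: continuous_on_discrete)
    then show ?thesis by (simp add: e_def Bcontfun_inverse)
  qed
  define \<phi> where "\<phi> x = (\<Sum>i<r. x i *\<^sub>R e i)" for x :: "nat \<Rightarrow> real"
  have \<phi>: "apply_bcontfun (\<phi> x) j = x j" if "j < r" for x j
  proof -
    have "apply_bcontfun (\<phi> x) j = (\<Sum>i<r. x i * apply_bcontfun (e i) j)"
      unfolding \<phi>_def by (induction r) (auto simp: plus_bcontfun.rep_eq)
    also have "\<dots> = x j" using that by (simp add: e if_distrib cong: if_cong)
    finally show ?thesis .
  qed
  have "continuous_on UNIV (\<lambda>v::nat \<Rightarrow>\<^sub>C real. apply_bcontfun v j)" for j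
  proof -
    have "bounded_linear (\<lambda>v::nat \<Rightarrow>\<^sub>C real. apply_bcontfun v j)"
      by (rule bounded_linear_intro[where K = 1]) (use norm_bounded in \<open>auto simp: real_norm_def[symmetric] simp del: real_norm_def\<close>)
    then show ?thesis by (rule linear_continuous_on)
  qed
  then have "continuous_on UNIV (apply_bcontfun :: (nat \<Rightarrow>\<^sub>C real) \<Rightarrow> nat \<Rightarrow> real)"
    by (rule continuous_on_coordinatewise_then_product)
  then have c: "continuous_on UNIV (\<lambda>v. F (apply_bcontfun v))"
    by (rule continuous_on_compose2[OF cont]) auto
  have nz: "F x \<noteq> 0" for x using norm[of x] by auto
  obtain g where g: "continuous_on UNIV g" "\<And>v. F (apply_bcontfun v) = exp (g v)"
    using continuous_logarithm_on_contractible[OF c convex_imp_contractible] nz by auto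
  have "continuous_on UNIV \<phi>"
    unfolding \<phi>_def by (intro continuous_intros continuous_on_coordinate)
  then have "continuous_on UNIV (\<lambda>x. Im (g (\<phi> x)))"
    by (intro continuous_intros continuous_on_compose2[OF g(1)]) auto
  moreover have "\<forall>x. F x = cis (Im (g (\<phi> x)))"
  proof
    fix x
    have eq: "F x = exp (g (\<phi> x))" unfolding g(2)[symmetric] by (rule dep) (simp add: \<phi>)
    then have "Re (g (\<phi> x)) = 0" using norm[of x] by simp
    then show "F x = cis (Im (g (\<phi> x)))" unfolding eq by (simp add: exp_eq_polar)
  qed
  moreover have "\<forall>x y. (\<forall>i<r. x i = y i) \<longrightarrow> Im (g (\<phi> x)) = Im (g (\<phi> y))"
  proof (intro allI impI)
    fix x y :: "nat \<Rightarrow> real" assume "\<forall>i<r. x i = y i"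
    then have "\<phi> x = \<phi> y" by (simp add: \<phi>_def)
    then show "Im (g (\<phi> x)) = Im (g (\<phi> y))" by simp
  qed
  ultimately show ?thesis by (intro exI[of _ "\<lambda>x. Im (g (\<phi> x))"] conjI)
qed

lemma connected_UNIV_fun: "connected (UNIV :: (nat \<Rightarrow> real) set)"
proof (rule connectedI_const)
  fix P :: "(nat \<Rightarrow> real) \<Rightarrow> bool" assume P: "continuous_on UNIV P"
  have "P x = P (\<lambda>_. 0)" for x
  proof -
    have "continuous_on UNIV (\<lambda>s::real. (\<lambda>i. s * x i))"
      by (intro continuous_on_coordinatewise_then_product continuous_intros)
    then have "continuous_on UNIV (\<lambda>s::real. P (\<lambda>i. s * x i))"
      by (rule continuous_on_compose2[OF P]) auto
    then obtain c where "\<And>s. P (\<lambda>i. s * x i) = c"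
      using connectedD_const[of "UNIV::real set"] by auto
    from this[of 1] this[of 0] show ?thesis by simp
  qed
  then show "\<exists>c. \<forall>s\<in>UNIV. P s = c" by blast
qed

text \<open>Shifting coordinate i by 2 pi changes a lift h by a multiple of 2 pi that cannot depend
  on the point; this is the degree \<open>m i\<close>. Subtracting the linear form with these
  coefficients removes all increments and leaves a periodic remainder.\<close>

lemma periodic_circle_lift:
  fixes F :: "(nat \<Rightarrow> real) \<Rightarrow> complex"
  assumes cont: "continuous_on UNIV F" and norm: "\<And>x. norm (F x) = 1"
    and per: "\<And>x y. \<forall>i<r. cis (x i) = cis (y i) \<Longrightarrow> F x = F y"
  shows "\<exists>(m::nat \<Rightarrow> int) k. continuous_on UNIV k \<and> (\<forall>x. F x = cis ((\<Sum>i<r. of_int (m i) * x i) + k x)) \<and>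
    (\<forall>x y. (\<forall>i<r. cis (x i) = cis (y i)) \<longrightarrow> k x = k y)"
proof -
  obtain h where h: "continuous_on UNIV h" "\<And>x. F x = cis (h x)"
    and hdep: "\<And>x y. \<forall>i<r. x i = y i \<Longrightarrow> h x = h y"
  proof -
    have "F x = F y" if "\<forall>i<r. x i = y i" for x y using that by (intro per) simp
    from continuous_circle_lift[OF cont norm this] show ?thesis using that by blast
  qed
  have "\<exists>m::int. \<forall>x. h (x(i := x i + 2 * pi)) = h x + 2 * pi * m" for i
  proof -
    define f where "f x = (h (x(i := x i + 2 * pi)) - h x) / (2 * pi)" for x
    have "F (x(i := x i + 2 * pi)) = F x" for x
    proof (rule per, intro allI impI)
      fix j show "cis ((x(i := x i + 2 * pi)) j) = cis (x j)"
        by (simp add: complex_eq_iff)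
    qed
    then have f: "f x \<in> \<int>" for x
      unfolding f_def cis_eq_cis_iff[symmetric] by (simp flip: h(2))
    have "continuous_on UNIV (\<lambda>x::nat \<Rightarrow> real. x(i := x i + 2 * pi))"
    proof (rule continuous_on_coordinatewise_then_product)
      fix j show "continuous_on UNIV (\<lambda>x::nat \<Rightarrow> real. (x(i := x i + 2 * pi)) j)"
      proof (cases "j = i")
        case True
        have "continuous_on UNIV (\<lambda>x::nat \<Rightarrow> real. x i + 2 * pi)" by (intro continuous_intros continuous_on_coordinate)
        then show ?thesis using True by simp
      qed (simp add: continuous_on_coordinate)
    qed
    then have "continuous_on UNIV (\<lambda>x. h (x(i := x i + 2 * pi)))"
      by (rule continuous_on_compose2[OF h(1)]) auto
    then have "continuous_on UNIV f" unfolding f_def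
      by (intro continuous_intros h(1)) auto
    then have const: "f x = f (\<lambda>_. 0)" for x
      using Ints_valued_constant[OF connected_UNIV_fun] f by blast
    obtain m where "f (\<lambda>_. 0) = of_int m" using f by (meson Ints_cases)
    then have "h (x(i := x i + 2 * pi)) = h x + 2 * pi * m" for x
      using const[of x] by (simp add: f_def field_simps)
    then show ?thesis by blast
  qed
  then obtain m :: "nat \<Rightarrow> int" where m: "\<And>i x. h (x(i := x i + 2 * pi)) = h x + 2 * pi * m i" by metis
  define k where "k x = h x - (\<Sum>i<r. of_int (m i) * x i)" for x
  have kdep: "k x = k y" if "\<forall>i<r. x i = y i" for x y
    using that hdep[OF that] by (simp add: k_def)
  have k1: "k (x(i := x i + 2 * pi)) = k x" if "i < r" for x i
  proof -
    have "(\<Sum>j<r. of_int (m j) * (x(i := x i + 2 * pi)) j) = (\<Sum>j<r. of_int (m j) * x j + (if j = i then of_int (m i) * (2 * pi) else 0))"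
      by (intro sum.cong) (auto simp: algebra_simps)
    also have "\<dots> = (\<Sum>j<r. of_int (m j) * x j) + of_int (m i) * (2 * pi)"
      using that by (simp add: sum.distrib)
    finally show ?thesis using m[of x i] by (simp add: k_def)
  qed
  have k2: "k (x(i := x i + 2 * pi * real n)) = k x" if "i < r" for x i n
  proof (induction n)
    case (Suc n)
    define w where "w = x(i := x i + 2 * pi * real n)"
    have "x(i := x i + 2 * pi * real (Suc n)) = w(i := w i + 2 * pi)"
      by (auto simp: w_def algebra_simps)
    then show ?case using k1[OF that, of w] Suc by (simp only: w_def[symmetric])
  qed simp
  have k3: "k (x(i := x i + 2 * pi * of_int z)) = k x" if "i < r" for x i and z :: int
  proof (cases z rule: int_cases2)
    case (nonneg n)
    then show ?thesis using k2[OF that] by simp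
  next
    case (nonpos n)
    have "k ((x(i := x i - 2 * pi * real n))(i := (x(i := x i - 2 * pi * real n)) i + 2 * pi * real n)) = k (x(i := x i - 2 * pi * real n))"
      by (rule k2[OF that])
    then show ?thesis using nonpos by simp
  qed
  have "k x = k y" if xy: "\<forall>i<r. cis (x i) = cis (y i)" for x y
  proof -
    \<comment> \<open>The coordinates of x are exchanged for those of y one at a time; each exchange
      is a shift by a multiple of 2 pi.\<close>
    have "j \<le> r \<Longrightarrow> k (\<lambda>i. if i < j then y i else x i) = k x" for j
    proof (induction j)
      case (Suc j)
      define w where "w = (\<lambda>i. if i < j then y i else x i)"
      have "(y j - x j) / (2 * pi) \<in> \<int>" using xy Suc.prems by (metis Suc_le_lessD cis_eq_cis_iff)
      then obtain z :: int where "(y j - x j) / (2 * pi) = z" by (auto elim: Ints_cases)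
      then have "y j = w j + 2 * pi * z" by (simp add: w_def field_simps)
      then have "(\<lambda>i. if i < Suc j then y i else x i) = w(j := w j + 2 * pi * z)"
        by (auto simp: w_def less_Suc_eq)
      then show ?case using k3[of j w z] Suc by (simp add: w_def)
    qed simp
    from this[of r] show ?thesis using kdep[of "\<lambda>i. if i < r then y i else x i" y] by simp
  qed
  moreover have "continuous_on UNIV k"
    unfolding k_def by (intro continuous_intros h(1) continuous_on_coordinate)
  moreover have "F x = cis ((\<Sum>i<r. of_int (m i) * x i) + k x)" for x
    by (simp add: h(2) k_def)
  ultimately show ?thesis by blast
qed

text \<open>The principal argument jumps on the negative axis. Near z0 it is replaced by the
  argument of z0 plus that of z / z0, which is continuous and differs from it by multiples of 2 pi,
  invisible to \<open>k\<close>. The domain constrains only the first \<open>r\<close> coordinates,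
  so it accommodates points of a torus as well as value vectors of characters.\<close>

lemma continuous_on_periodic_descend:
  fixes k :: "(nat \<Rightarrow> real) \<Rightarrow> real"
  assumes "continuous_on UNIV k" "\<And>x y. \<forall>i<r. cis (x i) = cis (y i) \<Longrightarrow> k x = k y"
  shows "continuous_on {z. \<forall>i<r. norm (z i) = 1} (\<lambda>z. k (\<lambda>i. Im (Ln (z i))))"
proof (rule continuous_on_local)
  fix z0 :: "nat \<Rightarrow> complex" assume z0: "z0 \<in> {z. \<forall>i<r. norm (z i) = 1}"
  define U where "U = (\<Inter>i<r. {z. Re (z i / z0 i) > 0})"
  have nz: "z0 i \<noteq> 0" if "i < r" for i using z0 that by auto
  have "open {z. Re (z i / z0 i) > 0}" if "i < r" for i
    using nz[OF that] by (intro open_Collect_less continuous_intros continuous_on_coordinate) auto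
  then have "open U" unfolding U_def by (intro open_INT) auto
  moreover have "z0 \<in> U" using nz by (auto simp: U_def)
  moreover have "continuous_on ({z. \<forall>i<r. norm (z i) = 1} \<inter> U) (\<lambda>z. k (\<lambda>i. Im (Ln (z i))))" (is "continuous_on ?S _")
  proof -
    have "continuous_on ?S (\<lambda>z i. if i < r then Im (Ln (z0 i)) + Im (Ln (z i / z0 i)) else 0)"
    proof (rule continuous_on_coordinatewise_then_product)
      fix i show "continuous_on ?S (\<lambda>z. if i < r then Im (Ln (z0 i)) + Im (Ln (z i / z0 i)) else 0)"
      proof (cases "i < r")
        case True
        have "z i / z0 i \<notin> \<real>\<^sub>\<le>\<^sub>0" if "z \<in> ?S" for z
        proof -
          have "Re (z i / z0 i) > 0" using that True unfolding U_def by blast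
          then show ?thesis by (auto simp: complex_nonpos_Reals_iff simp del: Re_divide Im_divide)
        qed
        then have "continuous_on ?S (\<lambda>z. Im (Ln (z0 i)) + Im (Ln (z i / z0 i)))"
          using nz[OF True] by (intro continuous_intros continuous_on_coordinate) auto
        then show ?thesis using True by simp
      qed simp
    qed
    then have "continuous_on ?S (\<lambda>z. k (\<lambda>i. if i < r then Im (Ln (z0 i)) + Im (Ln (z i / z0 i)) else 0))"
      by (rule continuous_on_compose2[OF assms(1)]) auto
    moreover have "k (\<lambda>i. if i < r then Im (Ln (z0 i)) + Im (Ln (z i / z0 i)) else 0) = k (\<lambda>i. Im (Ln (z i)))"
      if "z \<in> ?S" for z
    proof (rule assms(2), intro allI impI)
      fix i assume i: "i < r"
      have "norm (z i) = 1" "norm (z0 i) = 1" using that z0 i by auto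
      then show "cis (if i < r then Im (Ln (z0 i)) + Im (Ln (z i / z0 i)) else 0) = cis (Im (Ln (z i)))"
        using i nz[OF i] by (simp flip: cis_mult add: cis_Im_Ln norm_divide)
    qed
    ultimately show ?thesis by (rule continuous_on_eq)
  qed
  ultimately show "\<exists>U. open U \<and> z0 \<in> U \<and> continuous_on ({z. \<forall>i<r. norm (z i) = 1} \<inter> U) (\<lambda>z. k (\<lambda>i. Im (Ln (z i))))"
    by blast
qed

text \<open>Homotopy classes of maps from a torus to the circle are given by degrees: pull back
  along the exponential covering, split off the degrees there, and let the periodic remainder
  descend.\<close>

lemma torus_circle_map:
  fixes f :: "(nat \<Rightarrow> complex) \<Rightarrow> complex"
  assumes cont: "continuous_on ({..<r} \<rightarrow>\<^sub>E circle) f" and norm: "\<And>z. z \<in> {..<r} \<rightarrow>\<^sub>E circle \<Longrightarrow> norm (f z) = 1"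
  shows "\<exists>(m::nat \<Rightarrow> int) K. continuous_on ({..<r} \<rightarrow>\<^sub>E circle) K \<and>
    (\<forall>z\<in>{..<r} \<rightarrow>\<^sub>E circle. f z = (\<Prod>i<r. z i powi m i) * cis (K z))"
proof -
  define F where "F x = f (\<lambda>i\<in>{..<r}. cis (x i))" for x :: "nat \<Rightarrow> real"
  have "continuous_on UNIV (\<lambda>x::nat \<Rightarrow> real. (\<lambda>i\<in>{..<r}. cis (x i)))"
  proof (rule continuous_on_coordinatewise_then_product)
    fix i show "continuous_on UNIV (\<lambda>x::nat \<Rightarrow> real. (\<lambda>i\<in>{..<r}. cis (x i)) i)"
      by (cases "i < r") (auto intro!: continuous_on_cis_comp continuous_on_coordinate)
  qed
  then have Fc: "continuous_on UNIV F"
    unfolding F_def by (rule continuous_on_compose2[OF cont]) (auto simp: circle_def restrict_def PiE_def extensional_def split: if_splits)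
  have Fn: "norm (F x) = 1" for x unfolding F_def by (rule norm) (auto simp: circle_def)
  have per: "F x = F y" if "\<forall>i<r. cis (x i) = cis (y i)" for x y
  proof -
    have "(\<lambda>i\<in>{..<r}. cis (x i)) = (\<lambda>i\<in>{..<r}. cis (y i))" using that by auto
    then show ?thesis by (simp add: F_def)
  qed
  obtain m k where k: "continuous_on UNIV k" "\<And>x. F x = cis ((\<Sum>i<r. of_int (m i) * x i) + k x)"
    and kper: "\<And>x y. \<forall>i<r. cis (x i) = cis (y i) \<Longrightarrow> k x = k y"
    using periodic_circle_lift[OF Fc Fn per] by blast
  define K where "K z = k (\<lambda>i. Im (Ln (z i)))" for z :: "nat \<Rightarrow> complex"
  have "continuous_on {z. \<forall>i<r. norm (z i) = 1} K"
    unfolding K_def by (rule continuous_on_periodic_descend[OF k(1) kper])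
  then have "continuous_on ({..<r} \<rightarrow>\<^sub>E circle) K"
    by (rule continuous_on_subset) (auto simp: circle_def PiE_def Pi_def)
  moreover have "f z = (\<Prod>i<r. z i powi m i) * cis (K z)" if z: "z \<in> {..<r} \<rightarrow>\<^sub>E circle" for z
  proof -
    have cz: "cis (Im (Ln (z i))) = z i" if "i < r" for i
      using z that by (intro cis_Im_Ln) (auto simp: circle_def PiE_def Pi_def)
    have "(\<lambda>i\<in>{..<r}. cis (Im (Ln (z i)))) = z"
      using z cz by (auto simp: fun_eq_iff PiE_def extensional_def restrict_def)
    then have "f z = F (\<lambda>i. Im (Ln (z i)))" by (simp add: F_def)
    also have "\<dots> = (\<Prod>i<r. cis (Im (Ln (z i))) powi m i) * cis (K z)"
      by (simp add: k(2) K_def cis_sum flip: cis_mult cis_power_int)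
    also have "\<dots> = (\<Prod>i<r. z i powi m i) * cis (K z)" using cz by simp
    finally show ?thesis .
  qed
  ultimately show ?thesis by blast
qed

text \<open>This turns the torus and the dual into plain subsets of function types, where
  \<open>continuous_on\<close>, \<open>compact\<close> and \<open>connected\<close> are
  available.\<close>

lemma product_topology_eq_top_of_set:
  fixes C :: "'b::topological_space set"
  shows "product_topology (\<lambda>_. top_of_set C) I = top_of_set (I \<rightarrow>\<^sub>E C)" (is "?P = ?T")
proof -
  have 1: "continuous_map ?P ?T id"
  proof -
    have "continuous_map ?P euclidean (\<lambda>f. f i)" for i
    proof (cases "i \<in> I")
      case True
      then show ?thesis
        using continuous_map_product_projection[OF True, of "\<lambda>_. top_of_set C"] continuous_map_in_subtopology by blast
    next
      case False
      \<comment> \<open>Outside I every extensional function has the value \<open>undefined\<close>,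
        so the projection is constant there.\<close>
      have "continuous_map ?P euclidean (\<lambda>f. undefined :: 'b)" by simp
      then show ?thesis
        by (rule continuous_map_eq) (use False in \<open>auto simp: PiE_def extensional_def\<close>)
    qed
    then have "continuous_map ?P euclidean id"
      unfolding euclidean_product_topology[symmetric] continuous_map_componentwise_UNIV by simp
    then show ?thesis by (simp add: continuous_map_in_subtopology)
  qed
  have 2: "continuous_map ?T ?P id"
    unfolding continuous_map_componentwise
  proof (intro conjI ballI)
    show "id ` topspace ?T \<subseteq> extensional I" by (auto simp: PiE_def)
    fix i assume "i \<in> I"
    have "continuous_on (I \<rightarrow>\<^sub>E C) (\<lambda>f. f i)" by (rule continuous_on_coordinate)
    then show "continuous_map ?T (top_of_set C) (\<lambda>f. id f i)"
      using \<open>i \<in> I\<close> by (auto simp: continuous_map_in_subtopology)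
  qed
  show ?thesis
  proof (rule topology_eq[THEN iffD2], intro allI)
    fix S
    have "openin ?P S" if "openin ?T S"
    proof -
      have "openin ?P {x \<in> topspace ?P. id x \<in> S}" using 1 that by (rule openin_continuous_map_preimage)
      moreover have "{x \<in> topspace ?P. id x \<in> S} = S" using openin_subset[OF that] by auto
      ultimately show ?thesis by simp
    qed
    moreover have "openin ?T S" if "openin ?P S"
    proof -
      have "openin ?T {x \<in> topspace ?T. id x \<in> S}" using 2 that by (rule openin_continuous_map_preimage)
      moreover have "{x \<in> topspace ?T. id x \<in> S} = S" using openin_subset[OF that] by auto
      ultimately show ?thesis by simp
    qed
    ultimately show "openin ?P S = openin ?T S" by blast
  qed
qed

section \<open>The space of characters\<close>

definition exp_char :: "('a, 'b) monoid_scheme \<Rightarrow> ('a \<Rightarrow> real) \<Rightarrow> 'a \<Rightarrow> complex" where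
  "exp_char G t = (\<lambda>a\<in>carrier G. cis (t a))"

lemma exp_char_apply [simp]: "a \<in> carrier G \<Longrightarrow> exp_char G t a = cis (t a)"
  by (simp add: exp_char_def)

lemma charactersD:
  assumes "\<gamma> \<in> characters G"
  shows "\<And>x y. x \<in> carrier G \<Longrightarrow> y \<in> carrier G \<Longrightarrow> \<gamma> (x \<otimes>\<^bsub>G\<^esub> y) = \<gamma> x * \<gamma> y"
    and "\<And>x. x \<in> carrier G \<Longrightarrow> norm (\<gamma> x) = 1"
    and "\<And>x. x \<in> carrier G \<Longrightarrow> \<gamma> x \<noteq> 0"
    and "\<And>x. x \<notin> carrier G \<Longrightarrow> \<gamma> x = undefined"
proof -
  show 1: "norm (\<gamma> x) = 1" if "x \<in> carrier G" for x
    using assms that by (auto simp: characters_def circle_def PiE_def Pi_def)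
  show "\<gamma> x \<noteq> 0" if "x \<in> carrier G" for x
    using 1[OF that] by auto
qed (use assms in \<open>auto simp: characters_def PiE_def extensional_def\<close>)

lemma exp_char_in_characters: "t \<in> real_homs G \<Longrightarrow> monoid G \<Longrightarrow> exp_char G t \<in> characters G"
  by (auto simp: characters_def circle_def exp_char_def real_homsD cis_mult monoid.m_closed)

lemma pontryagin_dual_eq: "pontryagin_dual G = top_of_set (characters G)"
proof -
  have "(carrier G \<rightarrow>\<^sub>E circle) \<inter> characters G = characters G" by (auto simp: characters_def)
  then show ?thesis
    by (simp add: pontryagin_dual_def product_topology_eq_top_of_set subtopology_subtopology)
qed

lemma torus_eq: "torus n = top_of_set ({..<n} \<rightarrow>\<^sub>E circle)"
  by (simp add: torus_def product_topology_eq_top_of_set)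

lemma compact_PiE_circle: "compact (I \<rightarrow>\<^sub>E circle)"
proof -
  have "compact circle"
    using compact_sphere[of "0::complex" 1] by (simp add: circle_def sphere_def dist_norm)
  then have "compact_space (product_topology (\<lambda>_. top_of_set circle) I)"
    by (simp add: compact_space_product_topology compact_space_subtopology)
  then show ?thesis
    by (simp add: product_topology_eq_top_of_set compact_space_def compactin_subtopology)
qed

lemma compact_characters: "compact (characters G)"
proof -
  have "closed {\<gamma>::'a \<Rightarrow> complex. \<gamma> (x \<otimes>\<^bsub>G\<^esub> y) = \<gamma> x * \<gamma> y}" for x y
    by (intro closed_Collect_eq continuous_intros continuous_on_coordinate)
  then have "closed (\<Inter>x\<in>carrier G. \<Inter>y\<in>carrier G. {\<gamma>::'a \<Rightarrow> complex. \<gamma> (x \<otimes>\<^bsub>G\<^esub> y) = \<gamma> x * \<gamma> y})"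
    by (intro closed_INT) auto
  then have "compact ((carrier G \<rightarrow>\<^sub>E circle) \<inter> (\<Inter>x\<in>carrier G. \<Inter>y\<in>carrier G. {\<gamma>::'a \<Rightarrow> complex. \<gamma> (x \<otimes>\<^bsub>G\<^esub> y) = \<gamma> x * \<gamma> y}))"
    by (rule compact_Int_closed[OF compact_PiE_circle])
  also have "(carrier G \<rightarrow>\<^sub>E circle) \<inter> (\<Inter>x\<in>carrier G. \<Inter>y\<in>carrier G. {\<gamma>::'a \<Rightarrow> complex. \<gamma> (x \<otimes>\<^bsub>G\<^esub> y) = \<gamma> x * \<gamma> y}) = characters G"
    by (auto simp: characters_def)
  finally show ?thesis .
qed

lemma continuous_on_exp_char_sum:
  "continuous_on UNIV (\<lambda>x::nat \<Rightarrow> real. exp_char G (\<lambda>a. \<Sum>j<m. x j * t j a))"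
proof (rule continuous_on_coordinatewise_then_product)
  fix a show "continuous_on UNIV (\<lambda>x::nat \<Rightarrow> real. exp_char G (\<lambda>a. \<Sum>j<m. x j * t j a) a)"
    by (cases "a \<in> carrier G")
      (auto simp: exp_char_def intro!: continuous_on_cis_comp continuous_intros continuous_on_coordinate)
qed

lemma continuous_on_exp_char_line:
  "continuous_on UNIV (\<lambda>s::real. exp_char G (\<lambda>a. s * t a))"
proof (rule continuous_on_coordinatewise_then_product)
  fix a show "continuous_on UNIV (\<lambda>s::real. exp_char G (\<lambda>a. s * t a) a)"
    by (cases "a \<in> carrier G") (auto simp: exp_char_def intro!: continuous_on_cis_comp continuous_intros)
qed

text \<open>A basic open set of the product topology restricts finitely many coordinates. A
  character can thus be moved into a given neighbourhood by matching finitely many values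
  exactly.\<close>

lemma open_fun_finite_support:
  fixes V :: "('a \<Rightarrow> 'b::topological_space) set"
  assumes "open V" "f \<in> V"
  shows "\<exists>S. finite S \<and> (\<forall>g. (\<forall>s\<in>S. g s = f s) \<longrightarrow> g \<in> V)"
proof -
  have "openin (product_topology (\<lambda>_. euclidean) UNIV) V"
    using assms(1) by (simp add: euclidean_product_topology)
  from product_topology_open_contains_basis[OF this assms(2)]
  obtain U where "f \<in> (\<Pi>\<^sub>E i\<in>UNIV. U i) \<and> (\<forall>i. openin euclidean (U i)) \<and>
    finite {i. U i \<noteq> topspace euclidean} \<and> (\<Pi>\<^sub>E i\<in>UNIV. U i) \<subseteq> V" ..
  then have U: "f \<in> (\<Pi>\<^sub>E i\<in>UNIV. U i)" "finite {i. U i \<noteq> topspace euclidean}" "(\<Pi>\<^sub>E i\<in>UNIV. U i) \<subseteq> V"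
    by simp_all
  have "g \<in> V" if g: "\<forall>s\<in>{i. U i \<noteq> topspace euclidean}. g s = f s" for g
  proof -
    have "g i \<in> U i" for i
    proof (cases "U i = UNIV")
      case False
      then have "g i = f i" using g by auto
      then show ?thesis using U(1) by (auto simp: PiE_def Pi_def)
    qed auto
    then show ?thesis using U(3) by auto
  qed
  then show ?thesis using U(2) by blast
qed

section \<open>Connectedness of the dual and phases of functions on it\<close>

context comm_group
begin

lemma real_homs_zero: "(\<lambda>_. 0) \<in> real_homs G"
  by (simp add: real_homs_def)

lemma char_lincomb:
  assumes "\<gamma> \<in> characters G" "\<And>i. i < m \<Longrightarrow> b i \<in> carrier G"
  shows "\<gamma> (lincomb G b m c) = (\<Prod>i<m. \<gamma> (b i) powi c i)"
  using assms charactersD[OF assms(1)] by (intro lincomb_hom) auto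

lemma char_inv:
  assumes "\<gamma> \<in> characters G" "x \<in> carrier G"
  shows "\<gamma> (inv x) = inverse (\<gamma> x)"
proof -
  have "\<gamma> \<one> = 1"
    using charactersD(1)[OF assms(1), of \<one> \<one>] charactersD(3)[OF assms(1), of \<one>] by simp
  then show ?thesis
    using charactersD(1)[OF assms(1), of x "inv x"] charactersD(3)[OF assms(1,2)] assms(2)
    by (simp add: field_simps)
qed

lemma characters_agree_lincomb:
  assumes "\<gamma> \<in> characters G" "\<gamma>' \<in> characters G" "\<And>i. i < m \<Longrightarrow> b i \<in> carrier G"
    "\<And>i. i < m \<Longrightarrow> \<gamma> (b i) = \<gamma>' (b i)" "s \<in> range (lincomb G b m)"
  shows "\<gamma> s = \<gamma>' s"
proof -
  obtain c where "s = lincomb G b m c" using assms(5) by blast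
  then show ?thesis using assms by (simp add: char_lincomb)
qed

lemma exp_char_dual_family:
  assumes "dual_family G b t m" "j < m"
  shows "exp_char G (\<lambda>a. \<Sum>i<m. x i * t i a) (b j) = cis (x j)"
proof -
  have "(\<Sum>i<m. x i * t i (b j)) = (\<Sum>i<m. x i * (if i = j then 1 else 0))"
    using assms by (intro sum.cong) (auto simp: dual_family_def)
  also have "\<dots> = x j" using assms(2) by (simp add: if_distrib cong: if_cong)
  finally show ?thesis using assms by (simp add: dual_family_def)
qed

lemma real_homs_dual_sum: "dual_family G b t m \<Longrightarrow> (\<lambda>a. \<Sum>i<m. x i * t i a) \<in> real_homs G"
  by (rule real_homs_sum) (auto simp: dual_family_def)

text \<open>On a basis of a subgroup containing \<open>S\<close> one picks arguments of the values
  of the character and combines the dual functionals accordingly. The finite set is essential: the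
  dual of the rationals is not path connected, so not all its characters are exponentials.\<close>

lemma character_locally_exp:
  assumes "torsion_free G" "finite S" "S \<subseteq> carrier G" "\<gamma> \<in> characters G"
  shows "\<exists>t\<in>real_homs G. \<forall>s\<in>S. \<gamma> s = cis (t s)"
proof -
  obtain m b t where d: "dual_family G b t m" and S: "S \<subseteq> range (lincomb G b m)"
    using dual_family_span[OF assms(1-3)] by blast
  have b: "b i \<in> carrier G" if "i < m" for i using d that by (auto simp: dual_family_def)
  define u where "u = (\<lambda>a. \<Sum>i<m. Im (Ln (\<gamma> (b i))) * t i a)"
  have u: "u \<in> real_homs G" unfolding u_def by (rule real_homs_dual_sum[OF d])
  have "\<gamma> s = exp_char G u s" if "s \<in> S" for s
  proof (rule characters_agree_lincomb[OF assms(4) exp_char_in_characters[OF u is_monoid] b])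
    show "s \<in> range (lincomb G b m)" using that S by blast
    show "\<gamma> (b i) = exp_char G u (b i)" if "i < m" for i
      unfolding u_def using exp_char_dual_family[OF d that] charactersD(2)[OF assms(4) b[OF that]]
      by (simp add: cis_Im_Ln)
  qed
  then show ?thesis using u assms(3) by (intro bexI[of _ u]) auto
qed

text \<open>A locally constant property takes the same value at a character and at some exponential
  matching it on a finite set; the line through that exponential leads to the trivial
  character.\<close>

lemma connected_characters:
  assumes "torsion_free G"
  shows "connected (characters G)"
proof (rule connectedI_const)
  fix P :: "('a \<Rightarrow> complex) \<Rightarrow> bool" assume P: "continuous_on (characters G) P"
  have "P \<gamma> = P (exp_char G (\<lambda>_. 0))" if \<gamma>: "\<gamma> \<in> characters G" for \<gamma>
  proof -
    obtain V where V: "open V" "V \<inter> characters G = P -` {P \<gamma>} \<inter> characters G"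
      using P open_discrete[of "{P \<gamma>}"] unfolding continuous_on_open_invariant by meson
    then have "\<gamma> \<in> V" using \<gamma> by blast
    then obtain S where S: "finite S" "\<And>g. \<forall>s\<in>S. g s = \<gamma> s \<Longrightarrow> g \<in> V"
      using open_fun_finite_support[OF V(1)] by blast
    obtain t where t: "t \<in> real_homs G" "\<forall>s\<in>S \<inter> carrier G. \<gamma> s = cis (t s)"
      using character_locally_exp[OF assms, of "S \<inter> carrier G"] S(1) \<gamma> by blast
    have tc: "exp_char G (\<lambda>a. s * t a) \<in> characters G" for s :: real
      by (rule exp_char_in_characters[OF real_homs_scale[OF t(1)] is_monoid])
    have "exp_char G t s = \<gamma> s" if "s \<in> S" for s
    proof (cases "s \<in> carrier G")
      case True
      then show ?thesis using that t(2) by simp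
    next
      case False
      then show ?thesis using charactersD(4)[OF \<gamma>] by (simp add: exp_char_def)
    qed
    then have "exp_char G t \<in> V" using S(2) by blast
    moreover have "exp_char G t \<in> characters G" by (rule exp_char_in_characters[OF t(1) is_monoid])
    ultimately have 1: "P (exp_char G t) = P \<gamma>" using V(2) by blast
    have "continuous_on UNIV (\<lambda>s. P (exp_char G (\<lambda>a. s * t a)))"
      using tc by (intro continuous_on_compose2[OF P continuous_on_exp_char_line]) auto
    then obtain c where c: "\<And>s. P (exp_char G (\<lambda>a. s * t a)) = c"
      using connectedD_const[of "UNIV::real set"] by auto
    show ?thesis using c[of 1] c[of 0] 1 by simp
  qed
  then show "\<exists>c. \<forall>\<gamma>\<in>characters G. P \<gamma> = c" by blast
qed

text \<open>If a were nontrivial, torsion-freeness would give a real homomorphism t with t a = 1.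
  Along exp(i s t) the phase \<open>k\<close> must equal s up to a constant, which compactness of
  the dual forbids.\<close>

lemma evaluation_not_exp:
  assumes tf: "torsion_free G" and a: "a \<in> carrier G" and k: "continuous_on (characters G) k"
    and eq: "\<And>\<gamma>. \<gamma> \<in> characters G \<Longrightarrow> \<gamma> a = cis (k \<gamma>)"
  shows "a = \<one>"
proof (rule ccontr)
  assume "a \<noteq> \<one>"
  then have "a [^] n \<notin> {\<one>}" if "n > 0" for n :: nat
    using tf a that by (auto simp: torsion_free_def)
  then obtain t where t: "t \<in> real_homs G" "t a = 1"
    using real_hom_separating[OF triv_subgroup a] by blast
  have tc: "exp_char G (\<lambda>a. s * t a) \<in> characters G" for s :: real
    by (rule exp_char_in_characters[OF real_homs_scale[OF t(1)] is_monoid])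
  define h where "h s = k (exp_char G (\<lambda>a. s * t a))" for s :: real
  have "continuous_on UNIV h"
    unfolding h_def using tc by (intro continuous_on_compose2[OF k continuous_on_exp_char_line]) auto
  then have c: "continuous_on UNIV (\<lambda>s. (h s - s) / (2 * pi))" by (intro continuous_intros) auto
  have "(h s - s) / (2 * pi) \<in> \<int>" for s
    using eq[OF tc[of s]] a t(2) by (simp add: h_def flip: cis_eq_cis_iff)
  then have const: "(h s - s) / (2 * pi) = (h 0 - 0) / (2 * pi)" for s
    using Ints_valued_constant[OF connected_UNIV c] by blast
  have h: "h s = h 0 + s" for s using const[of s] by simp
  have "bounded (k ` characters G)"
    using compact_continuous_image[OF k compact_characters] by (rule compact_imp_bounded)
  then obtain B where "\<And>\<gamma>. \<gamma> \<in> characters G \<Longrightarrow> \<bar>k \<gamma>\<bar> \<le> B" by (auto simp: bounded_iff)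
  then have "\<bar>h s\<bar> \<le> B" for s using tc by (simp add: h_def)
  \<comment> \<open>At this parameter the phase is B + 1, beyond its bound B.\<close>
  from this[of "B + 1 - h 0"] show False unfolding h[of "B + 1 - h 0"] by simp
qed

text \<open>Functions depending on finitely many values of the character form an algebra, and real
  and imaginary parts of single evaluations already separate characters; so Stone-Weierstrass
  applies.\<close>

lemma characters_finite_approx:
  assumes "continuous_on (characters G) f" "(e::real) > 0"
  shows "\<exists>g S. finite S \<and> S \<subseteq> carrier G \<and> continuous_on (characters G) g \<and>
    (\<forall>\<gamma>\<in>characters G. \<forall>\<delta>\<in>characters G. (\<forall>s\<in>S. \<gamma> s = \<delta> s) \<longrightarrow> g \<gamma> = g \<delta>) \<and>
    (\<forall>\<gamma>\<in>characters G. \<bar>f \<gamma> - g \<gamma>\<bar> < e)"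
proof -
  define D where "D g \<longleftrightarrow> continuous_on (characters G) g \<and> (\<exists>S. finite S \<and> S \<subseteq> carrier G \<and>
    (\<forall>\<gamma>\<in>characters G. \<forall>\<delta>\<in>characters G. (\<forall>s\<in>S. \<gamma> s = \<delta> s) \<longrightarrow> g \<gamma> = g \<delta>))" for g :: "('a \<Rightarrow> complex) \<Rightarrow> real"
  have op: "D (\<lambda>x. F (g x) (h x))" if gh: "D g" "D h" and c: "continuous_on (characters G) (\<lambda>x. F (g x) (h x))"
    for g h and F :: "real \<Rightarrow> real \<Rightarrow> real"
  proof -
    obtain S T where S: "finite S" "S \<subseteq> carrier G" "\<forall>\<gamma>\<in>characters G. \<forall>\<delta>\<in>characters G. (\<forall>s\<in>S. \<gamma> s = \<delta> s) \<longrightarrow> g \<gamma> = g \<delta>"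
      and T: "finite T" "T \<subseteq> carrier G" "\<forall>\<gamma>\<in>characters G. \<forall>\<delta>\<in>characters G. (\<forall>s\<in>T. \<gamma> s = \<delta> s) \<longrightarrow> h \<gamma> = h \<delta>"
      using gh unfolding D_def by blast
    have dep: "F (g \<gamma>) (h \<gamma>) = F (g \<delta>) (h \<delta>)"
      if "\<gamma> \<in> characters G" "\<delta> \<in> characters G" "\<forall>s\<in>S \<union> T. \<gamma> s = \<delta> s" for \<gamma> \<delta>
    proof -
      have "g \<gamma> = g \<delta>" "h \<gamma> = h \<delta>" using S(3) T(3) that by blast+
      then show ?thesis by simp
    qed
    show ?thesis unfolding D_def
    proof (intro conjI exI[of _ "S \<union> T"] ballI impI)
      show "finite (S \<union> T)" "S \<union> T \<subseteq> carrier G" using S(1,2) T(1,2) by auto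
    qed (fact c, rule dep)
  qed
  have cont: "continuous_on (characters G) g" if "D g" for g using that by (simp add: D_def)
  have "\<exists>g. D g \<and> (\<forall>\<gamma>\<in>characters G. \<bar>f \<gamma> - g \<gamma>\<bar> < e)"
  proof (rule Stone_Weierstrass_HOL[OF compact_characters, of D])
    show "D (\<lambda>x. c)" for c unfolding D_def by (intro conjI exI[of _ "{}"]) auto
    show "continuous_on (characters G) g" if "D g" for g using cont[OF that] .
    show "D (\<lambda>x. g x + h x)" if "D g \<and> D h" for g h
      using that op[of g h "(+)"] continuous_on_add[OF cont cont, of g h] by simp
    show "D (\<lambda>x. g x * h x)" if "D g \<and> D h" for g h
      using that op[of g h "(*)"] continuous_on_mult[OF cont cont, of g h] by simp
    fix \<gamma> \<delta> assume gd: "\<gamma> \<in> characters G \<and> \<delta> \<in> characters G \<and> \<gamma> \<noteq> \<delta>"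
    then obtain a where a: "\<gamma> a \<noteq> \<delta> a" by auto
    then have ac: "a \<in> carrier G" using gd charactersD(4)[of \<gamma> G a] charactersD(4)[of \<delta> G a] by metis
    have coord: "D (\<lambda>\<epsilon>. Re (\<epsilon> a))" "D (\<lambda>\<epsilon>. Im (\<epsilon> a))"
      unfolding D_def using ac
      by (auto intro!: exI[of _ "{a}"] continuous_on_Re continuous_on_Im continuous_on_coordinate)
    have "Re (\<gamma> a) \<noteq> Re (\<delta> a) \<or> Im (\<gamma> a) \<noteq> Im (\<delta> a)" using a by (simp add: complex_eq_iff)
    then show "\<exists>g. D g \<and> g \<gamma> \<noteq> g \<delta>" using coord by blast
  qed (use assms in auto)
  then show ?thesis unfolding D_def by blast
qed

text \<open>An approximation \<open>p\<close> of \<open>u\<close> that depends on finitely many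
  values is a function on a finite-dimensional torus, where degrees exist; they give the element
  \<open>b\<close>. The error u / p is close enough to the positive axis to have a continuous
  logarithm.\<close>

lemma circle_map_factor:
  assumes tf: "torsion_free G" and u: "continuous_on (characters G) u" "\<And>\<gamma>. \<gamma> \<in> characters G \<Longrightarrow> norm (u \<gamma>) = 1"
  shows "\<exists>b k. b \<in> carrier G \<and> continuous_on (characters G) k \<and> (\<forall>\<gamma>\<in>characters G. u \<gamma> = \<gamma> b * cis (k \<gamma>))"
proof -
  \<comment> \<open>An error below 1/2 in both the real and the imaginary part gives distance below
    1 from the unit circle value, so the approximation has no zero.\<close>
  have half: "(0::real) < 1/2" by simp
  obtain g1 S1 where 1: "finite S1" "S1 \<subseteq> carrier G" "continuous_on (characters G) g1"
    "\<forall>\<gamma>\<in>characters G. \<forall>\<delta>\<in>characters G. (\<forall>s\<in>S1. \<gamma> s = \<delta> s) \<longrightarrow> g1 \<gamma> = g1 \<delta>"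
    "\<forall>\<gamma>\<in>characters G. \<bar>Re (u \<gamma>) - g1 \<gamma>\<bar> < 1/2"
    using characters_finite_approx[OF continuous_on_Re[OF u(1)] half] by blast
  obtain g2 S2 where 2: "finite S2" "S2 \<subseteq> carrier G" "continuous_on (characters G) g2"
    "\<forall>\<gamma>\<in>characters G. \<forall>\<delta>\<in>characters G. (\<forall>s\<in>S2. \<gamma> s = \<delta> s) \<longrightarrow> g2 \<gamma> = g2 \<delta>"
    "\<forall>\<gamma>\<in>characters G. \<bar>Im (u \<gamma>) - g2 \<gamma>\<bar> < 1/2"
    using characters_finite_approx[OF continuous_on_Im[OF u(1)] half] by blast
  define p where "p \<gamma> = Complex (g1 \<gamma>) (g2 \<gamma>)" for \<gamma>
  have pc: "continuous_on (characters G) p"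
    unfolding p_def Complex_eq using 1(3) 2(3) by (intro continuous_intros)
  have pu: "norm (u \<gamma> - p \<gamma>) < 1" if "\<gamma> \<in> characters G" for \<gamma>
  proof -
    have "norm (u \<gamma> - p \<gamma>) \<le> \<bar>Re (u \<gamma> - p \<gamma>)\<bar> + \<bar>Im (u \<gamma> - p \<gamma>)\<bar>" by (rule cmod_le)
    also have "\<dots> < 1/2 + 1/2" using 1(5) 2(5) that by (intro add_strict_mono) (auto simp: p_def)
    finally show ?thesis by simp
  qed
  have p0: "p \<gamma> \<noteq> 0" if "\<gamma> \<in> characters G" for \<gamma> using pu[OF that] u(2)[OF that] by auto
  have pS: "p \<gamma> = p \<delta>" if "\<gamma> \<in> characters G" "\<delta> \<in> characters G" "\<forall>s\<in>S1 \<union> S2. \<gamma> s = \<delta> s" for \<gamma> \<delta>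
  proof -
    have "g1 \<gamma> = g1 \<delta>" "g2 \<gamma> = g2 \<delta>" using 1(4) 2(4) that by blast+
    then show ?thesis by (simp add: p_def)
  qed
  \<comment> \<open>The values on S1 and S2 are determined by those on a basis of a subgroup
    containing them, so \<open>p\<close> becomes a function of m circle coordinates.\<close>
  obtain m b t where d: "dual_family G b t m" and S: "S1 \<union> S2 \<subseteq> range (lincomb G b m)"
    using dual_family_span[OF tf, of "S1 \<union> S2"] 1(1,2) 2(1,2) by blast
  have b: "b i \<in> carrier G" if "i < m" for i using d that by (auto simp: dual_family_def)
  have pb: "p \<gamma> = p \<delta>" if "\<gamma> \<in> characters G" "\<delta> \<in> characters G" "\<forall>i<m. \<gamma> (b i) = \<delta> (b i)" for \<gamma> \<delta>
  proof (rule pS[OF that(1,2)], intro ballI)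
    fix s assume "s \<in> S1 \<union> S2"
    then have "s \<in> range (lincomb G b m)" using S by blast
    with that b show "\<gamma> s = \<delta> s" using characters_agree_lincomb[of \<gamma> \<delta> m b s] by simp
  qed
  define E where "E x = exp_char G (\<lambda>a. \<Sum>j<m. x j * t j a)" for x :: "nat \<Rightarrow> real"
  have E: "E x \<in> characters G" for x
    unfolding E_def by (rule exp_char_in_characters[OF real_homs_dual_sum[OF d] is_monoid])
  have Eb: "E x (b j) = cis (x j)" if "j < m" for x j
    unfolding E_def by (rule exp_char_dual_family[OF d that])
  define F where "F x = sgn (p (E x))" for x
  have Fc: "continuous_on UNIV F"
  proof -
    have "continuous_on UNIV (\<lambda>x. p (E x))"
      using E unfolding E_def by (intro continuous_on_compose2[OF pc continuous_on_exp_char_sum]) auto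
    then show ?thesis unfolding F_def using p0[OF E] by (intro continuous_on_sgn) auto
  qed
  have Fn: "norm (F x) = 1" for x using p0[OF E, of x] by (simp add: F_def norm_sgn)
  have Fp: "F x = F y" if "\<forall>i<m. cis (x i) = cis (y i)" for x y
    unfolding F_def using pb[OF E E, of x y] that by (simp add: Eb)
  obtain c k where k: "continuous_on UNIV k" "\<And>x. F x = cis ((\<Sum>i<m. of_int (c i) * x i) + k x)"
    and kp: "\<And>x y. \<forall>i<m. cis (x i) = cis (y i) \<Longrightarrow> k x = k y"
    using periodic_circle_lift[OF Fc Fn Fp] by blast
  define K where "K \<gamma> = k (\<lambda>i. Im (Ln (\<gamma> (b i))))" for \<gamma> :: "'a \<Rightarrow> complex"
  have 3: "continuous_on {z. \<forall>i<m. norm (z i) = 1} (\<lambda>z. k (\<lambda>i. Im (Ln (z i))))"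
    using k(1) kp by (rule continuous_on_periodic_descend)
  have 4: "continuous_on (characters G) (\<lambda>\<gamma> i. \<gamma> (b i))"
    by (intro continuous_on_coordinatewise_then_product continuous_on_coordinate)
  have 5: "(\<lambda>\<gamma> i. \<gamma> (b i)) ` characters G \<subseteq> {z. \<forall>i<m. norm (z i) = 1}"
  proof (intro image_subsetI CollectI allI impI)
    fix \<gamma> i assume "\<gamma> \<in> characters G" "i < m"
    then show "norm (\<gamma> (b i)) = 1" using charactersD(2)[of \<gamma> G "b i"] b by simp
  qed
  have Kc: "continuous_on (characters G) K"
    unfolding K_def using continuous_on_compose2[OF 3 4 5] .
  have sgnp: "sgn (p \<gamma>) = \<gamma> (lincomb G b m c) * cis (K \<gamma>)" if \<gamma>: "\<gamma> \<in> characters G" for \<gamma>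
  proof -
    have l: "cis (Im (Ln (\<gamma> (b i)))) = \<gamma> (b i)" if "i < m" for i
      using charactersD(2)[OF \<gamma> b[OF that]] by (rule cis_Im_Ln)
    have "p \<gamma> = p (E (\<lambda>i. Im (Ln (\<gamma> (b i)))))"
      by (rule pb[OF \<gamma> E]) (simp add: Eb l)
    then have "sgn (p \<gamma>) = F (\<lambda>i. Im (Ln (\<gamma> (b i))))" by (simp add: F_def)
    also have "\<dots> = (\<Prod>i<m. cis (Im (Ln (\<gamma> (b i)))) powi c i) * cis (K \<gamma>)"
      by (simp add: k(2) K_def cis_sum flip: cis_mult cis_power_int)
    also have "\<dots> = \<gamma> (lincomb G b m c) * cis (K \<gamma>)" using l b by (simp add: char_lincomb[OF \<gamma>])
    finally show ?thesis .
  qed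
  define L where "L \<gamma> = Im (Ln (u \<gamma> / p \<gamma>))" for \<gamma>
  \<comment> \<open>Since u has norm 1 and distance below 1 from p, the law of cosines puts them in
    a common open half-plane; hence u / p avoids the cut of \<open>Ln\<close>.\<close>
  have re: "Re (u \<gamma> / p \<gamma>) > 0" if "\<gamma> \<in> characters G" for \<gamma>
  proof -
    have "(norm (u \<gamma> - p \<gamma>))\<^sup>2 < 1" using pu[OF that] by (simp add: power_less_one_iff abs_square_less_1)
    moreover have "(norm (u \<gamma>))\<^sup>2 = 1" using u(2)[OF that] by simp
    moreover have "(norm (u \<gamma> - p \<gamma>))\<^sup>2 = (norm (u \<gamma>))\<^sup>2 + (norm (p \<gamma>))\<^sup>2 - 2 * Re (u \<gamma> * cnj (p \<gamma>))"
      unfolding cmod_power2 by (simp add: power2_eq_square algebra_simps)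
    ultimately have "2 * Re (u \<gamma> * cnj (p \<gamma>)) > (norm (p \<gamma>))\<^sup>2" by linarith
    then have "Re (u \<gamma> * cnj (p \<gamma>)) > 0" using zero_le_power2[of "norm (p \<gamma>)"] by linarith
    then show ?thesis using p0[OF that] by (simp add: Re_complex_div_gt_0)
  qed
  have Lc: "continuous_on (characters G) L"
  proof -
    have "u \<gamma> / p \<gamma> \<notin> \<real>\<^sub>\<le>\<^sub>0" if "\<gamma> \<in> characters G" for \<gamma>
      using re[OF that] by (auto simp: complex_nonpos_Reals_iff simp del: Re_divide Im_divide)
    then show ?thesis unfolding L_def using u(1) pc p0 by (intro continuous_intros) auto
  qed
  have uL: "u \<gamma> = sgn (p \<gamma>) * cis (L \<gamma>)" if "\<gamma> \<in> characters G" for \<gamma>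
  proof -
    have u0: "u \<gamma> \<noteq> 0" using u(2)[OF that] by auto
    have "cis (L \<gamma>) = sgn (u \<gamma> / p \<gamma>)"
      unfolding L_def using u0 p0[OF that] by (simp flip: Arg_eq_Im_Ln add: cis_Arg)
    also have "\<dots> = u \<gamma> / sgn (p \<gamma>)" using u(2)[OF that] by (simp add: sgn_divide sgn_eq[of "u \<gamma>"])
    finally show ?thesis using p0[OF that] by (simp add: sgn_eq_0_iff)
  qed
  have "u \<gamma> = \<gamma> (lincomb G b m c) * cis (K \<gamma> + L \<gamma>)" if "\<gamma> \<in> characters G" for \<gamma>
    using uL[OF that] sgnp[OF that] by (simp flip: cis_mult)
  moreover have "lincomb G b m c \<in> carrier G" using b by (rule lincomb_closed)
  moreover have "continuous_on (characters G) (\<lambda>\<gamma>. K \<gamma> + L \<gamma>)" using Kc Lc by (intro continuous_intros)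
  ultimately show ?thesis by blast
qed

end

section \<open>The dimension bound\<close>

text \<open>By invariance of domain the image would be open in dimension n + 1, yet it lies in the
  hyperplane where coordinate \<open>n\<close> vanishes.\<close>

lemma no_injection_lower_Euclidean_space:
  fixes f :: "(nat \<Rightarrow> real) \<Rightarrow> nat \<Rightarrow> real"
  assumes U: "openin (Euclidean_space (Suc n)) U" "x0 \<in> U" and f: "continuous_on U f" "inj_on f U"
    and low: "\<And>x i. x \<in> U \<Longrightarrow> i \<ge> n \<Longrightarrow> f x i = 0"
  shows False
proof -
  have Us: "U \<subseteq> topspace (Euclidean_space (Suc n))" using U(1) by (rule openin_subset)
  have "continuous_map (subtopology (Euclidean_space (Suc n)) U) (Euclidean_space (Suc n)) f"
    unfolding cm_Euclidean_space_iff_continuous_on using f(1) low Us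
    by (auto simp: Int_absorb1 topspace_Euclidean_space)
  then have "openin (Euclidean_space (Suc n)) (f ` U)"
    using invariance_of_domain_Euclidean_space[OF U(1)] f(2) by blast
  then have "\<exists>V. openin euclidean V \<and> f ` U = V \<inter> {x. \<forall>i\<ge>Suc n. x i = 0}"
    unfolding Euclidean_space_def euclidean_product_topology openin_subtopology .
  then obtain V where V: "open V" "f ` U = V \<inter> {x. \<forall>i\<ge>Suc n. x i = 0}"
    by (auto simp flip: open_openin)
  define y where "y = f x0"
  have yn: "y n = 0" using low[OF U(2), of n] by (simp add: y_def)
  \<comment> \<open>A short move from f x0 in direction n stays inside the open image but leaves the
    hyperplane.\<close>
  define g where "g s = y(n := s)" for s :: real
  have "continuous_on UNIV g"
  proof (rule continuous_on_coordinatewise_then_product)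
    fix i show "continuous_on UNIV (\<lambda>s. g s i)" by (cases "i = n") (auto simp: g_def)
  qed
  then have "open (g -` V)" using V(1) by (simp add: open_vimage)
  moreover have "g 0 = y" using yn by (auto simp: g_def)
  then have "0 \<in> g -` V" using V(2) U(2) by (auto simp: y_def)
  ultimately obtain e where e: "e > 0" "ball 0 e \<subseteq> g -` V" by (meson open_contains_ball)
  have "g (e / 2) \<in> V" using e by (auto simp: subset_iff)
  moreover have "g (e / 2) i = 0" if "i \<ge> Suc n" for i
    using that low[OF U(2), of i] by (simp add: g_def y_def)
  ultimately have "g (e / 2) \<in> f ` U" using V(2) by blast
  then obtain x where "x \<in> U" "f x = g (e / 2)" by auto
  then show False using low[of x n] e(1) by (simp add: g_def)
qed

text \<open>A nonzero polynomial has finitely many roots. Exponents start at 1, so the sums also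
  tend to 0 with s; the upper bound 2 pi in \<open>moment_vector_exists\<close> relies on
  this.\<close>

lemma eventually_moment_nonzero:
  fixes c :: "nat \<Rightarrow> real"
  assumes "\<exists>j<m. c j \<noteq> 0"
  shows "\<forall>\<^sub>F s in at 0. (\<Sum>j<m. c j * s ^ Suc j) \<noteq> 0"
proof -
  define p where "p = (\<Sum>j<m. Polynomial.monom (c j) (Suc j))"
  obtain j where j: "j < m" "c j \<noteq> 0" using assms by auto
  have "Polynomial.coeff p (Suc j) = c j" using j(1) by (simp add: p_def coeff_sum if_distrib cong: if_cong)
  then have "p \<noteq> 0" using j(2) by auto
  then have "finite ({s. poly p s = 0} - {0})" using poly_roots_finite by blast
  then have "open (- ({s. poly p s = 0} - {0}))" by (intro open_Compl finite_imp_closed)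
  moreover have "poly p s = (\<Sum>j<m. c j * s ^ Suc j)" for s by (simp add: p_def poly_sum poly_monom)
  ultimately show ?thesis
    unfolding eventually_at_topological by (intro exI[of _ "- ({s. poly p s = 0} - {0})"]) auto
qed

text \<open>The point \<open>(s, s\<^sup>2, \<dots>, s\<^sup>m)\<close> avoids finitely many hyperplanes for all small \<open>s \<noteq> 0\<close>.\<close>

lemma moment_vector_exists:
  fixes D :: "(nat \<Rightarrow> real) set"
  assumes "finite D"
  shows "\<exists>(x::nat \<Rightarrow> real) \<eta>. \<eta> > 0 \<and> \<eta> < 1 \<and> (\<forall>i\<ge>m. x i = 0) \<and>
    (\<forall>c\<in>D. (\<exists>j<m. c j \<noteq> 0) \<longrightarrow> 3 * \<eta> < \<bar>\<Sum>j<m. c j * x j\<bar> \<and> \<bar>\<Sum>j<m. c j * x j\<bar> + 3 * \<eta> < 2 * pi)"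
proof -
  define D' where "D' = {c\<in>D. \<exists>j<m. c j \<noteq> 0}"
  have fin: "finite D'" using assms by (simp add: D'_def)
  have "\<forall>\<^sub>F s in at 0. \<bar>\<Sum>j<m. c j * s ^ Suc j\<bar> < 2 * pi" for c :: "nat \<Rightarrow> real"
  proof -
    have "((\<lambda>s::real. \<bar>\<Sum>j<m. c j * s ^ Suc j\<bar>) \<longlongrightarrow> \<bar>\<Sum>j<m. c j * 0 ^ Suc j\<bar>) (at 0)"
      by (intro tendsto_intros)
    then show ?thesis by (rule order_tendstoD) simp
  qed
  then have "\<forall>\<^sub>F s in at 0. \<forall>c\<in>D'. (\<Sum>j<m. c j * s ^ Suc j) \<noteq> 0 \<and> \<bar>\<Sum>j<m. c j * s ^ Suc j\<bar> < 2 * pi"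
    using fin eventually_moment_nonzero by (intro eventually_ball_finite ballI eventually_conj) (auto simp: D'_def)
  then obtain s :: real where s: "\<forall>c\<in>D'. (\<Sum>j<m. c j * s ^ Suc j) \<noteq> 0 \<and> \<bar>\<Sum>j<m. c j * s ^ Suc j\<bar> < 2 * pi"
    using eventually_happens'[OF at_neq_bot] by blast
  define x where "x j = (if j < m then s ^ Suc j else 0)" for j
  have sx: "(\<Sum>j<m. c j * x j) = (\<Sum>j<m. c j * s ^ Suc j)" for c by (simp add: x_def)
  have small: "\<forall>\<^sub>F \<eta> in at_right 0. 3 * \<eta> < b" if "b > 0" for b :: real
    using that by (auto simp: eventually_at_right_field intro!: exI[of _ "b / 3"])
  have "\<forall>\<^sub>F \<eta> in at_right 0. \<forall>c\<in>D'. 3 * \<eta> < \<bar>\<Sum>j<m. c j * x j\<bar> \<and> 3 * \<eta> < 2 * pi - \<bar>\<Sum>j<m. c j * x j\<bar>"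
    using s unfolding sx[symmetric] by (intro eventually_ball_finite[OF fin] ballI eventually_conj small) auto
  then have "\<forall>\<^sub>F \<eta> in at_right 0. (\<forall>c\<in>D'. 3 * \<eta> < \<bar>\<Sum>j<m. c j * x j\<bar> \<and> 3 * \<eta> < 2 * pi - \<bar>\<Sum>j<m. c j * x j\<bar>) \<and> 3 * \<eta> < (3::real)"
    by (rule eventually_conj) (rule small, simp)
  moreover have "\<forall>\<^sub>F \<eta> in at_right 0. \<eta> > (0::real)" by (rule eventually_at_right_less)
  ultimately have "\<forall>\<^sub>F \<eta> in at_right 0. ((\<forall>c\<in>D'. 3 * \<eta> < \<bar>\<Sum>j<m. c j * x j\<bar> \<and> 3 * \<eta> < 2 * pi - \<bar>\<Sum>j<m. c j * x j\<bar>) \<and> 3 * \<eta> < (3::real)) \<and> \<eta> > 0"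
    by (rule eventually_conj)
  then obtain \<eta> :: real where e: "(\<forall>c\<in>D'. 3 * \<eta> < \<bar>\<Sum>j<m. c j * x j\<bar> \<and> 3 * \<eta> < 2 * pi - \<bar>\<Sum>j<m. c j * x j\<bar>) \<and> 3 * \<eta> < 3" "\<eta> > 0"
    using eventually_happens'[OF trivial_limit_at_right_real] by blast
  show ?thesis
    by (intro exI[of _ x] exI[of _ \<eta>]) (use e in \<open>auto simp: x_def D'_def\<close>)
qed

text \<open>The maps in \<open>F\<close> stand for the finitely many ways in which the acting group
  moves the tuple \<open>a\<close>; the lemma thus mentions no action, only that equal values of the
  \<open>u i\<close> imply agreement up to \<open>F\<close>. A neighbourhood in the (n +
  1)-parameter family would embed into n-space.\<close>

lemma (in comm_group) rank_le_dimension: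
  fixes u :: "nat \<Rightarrow> ('a \<Rightarrow> complex) \<Rightarrow> complex"
  assumes d: "dual_family G a t (Suc n)"
    and u: "\<And>i. i < n \<Longrightarrow> continuous_on (characters G) (u i)" "\<And>i \<gamma>. i < n \<Longrightarrow> \<gamma> \<in> characters G \<Longrightarrow> norm (u i \<gamma>) = 1"
    and fin: "finite F" and F: "\<And>\<sigma> j. \<sigma> \<in> F \<Longrightarrow> j < Suc n \<Longrightarrow> \<sigma> j \<in> carrier G"
    and sep: "\<And>\<gamma> \<delta>. \<gamma> \<in> characters G \<Longrightarrow> \<delta> \<in> characters G \<Longrightarrow> \<forall>i<n. u i \<gamma> = u i \<delta> \<Longrightarrow>
      \<exists>\<sigma>\<in>F. \<forall>j<Suc n. \<delta> (a j) = \<gamma> (\<sigma> j)"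
  shows False
proof -
  have a: "a i \<in> carrier G" if "i < Suc n" for i using d that by (auto simp: dual_family_def)
  define E where "E x = exp_char G (\<lambda>b. \<Sum>j<Suc n. x j * t j b)" for x :: "nat \<Rightarrow> real"
  have E: "E x \<in> characters G" for x
    unfolding E_def by (rule exp_char_in_characters[OF real_homs_dual_sum[OF d] is_monoid])
  have Ec: "continuous_on UNIV E" unfolding E_def by (rule continuous_on_exp_char_sum)
  \<comment> \<open>Real lifts of the \<open>u i\<close> replace a torus-valued map by a map into
    n-space, as invariance of domain for Euclidean spaces requires.\<close>
  have "\<exists>h. continuous_on UNIV h \<and> (\<forall>x. u i (E x) = cis (h x))" if "i < n" for i
  proof -
    have "continuous_on UNIV (\<lambda>x. u i (E x))"
      using E by (intro continuous_on_compose2[OF u(1)[OF that] Ec]) auto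
    moreover have "u i (E x) = u i (E y)" if "\<forall>i<Suc n. x i = y i" for x y
      using that by (simp add: E_def)
    ultimately show ?thesis using continuous_circle_lift[of "\<lambda>x. u i (E x)" "Suc n"] u(2)[OF that E] by blast
  qed
  then obtain h where h: "\<And>i. i < n \<Longrightarrow> continuous_on UNIV (h i)" "\<And>i x. i < n \<Longrightarrow> u i (E x) = cis (h i x)" by metis
  \<comment> \<open>As a linear form in x, \<open>c \<sigma> l\<close> is the change of argument
    when \<open>a l\<close> is replaced by \<open>\<sigma> l\<close> in the character with parameter
    x.\<close>
  define c where "c \<sigma> l j = t j (\<sigma> l) - (if j = l then 1 else 0)" for \<sigma> :: "nat \<Rightarrow> 'a" and l j
  define D where "D = (\<lambda>(\<sigma>, l). c \<sigma> l) ` (F \<times> {..<Suc n})"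
  have "finite D" using fin by (simp add: D_def)
  \<comment> \<open>On the neighbourhood chosen next, each form moves by less than \<eta> and the
    coordinates of two points differ by less than 2 \<eta>; hence the margin 3 \<eta>. The bound
    \<eta> < 1 keeps coordinate differences below 2 pi.\<close>
  from moment_vector_exists[OF this, of "Suc n"] obtain x0 \<eta> where eta: "\<eta> > 0" "\<eta> < 1" and x0: "\<forall>i\<ge>Suc n. x0 i = 0"
    and D: "\<And>c. c \<in> D \<Longrightarrow> \<exists>j<Suc n. c j \<noteq> 0 \<Longrightarrow> 3 * \<eta> < \<bar>\<Sum>j<Suc n. c j * x0 j\<bar> \<and> \<bar>\<Sum>j<Suc n. c j * x0 j\<bar> + 3 * \<eta> < 2 * pi"
    by blast
  define V where "V = (\<Inter>c\<in>D. {x. \<bar>(\<Sum>j<Suc n. c j * x j) - (\<Sum>j<Suc n. c j * x0 j)\<bar> < \<eta>}) \<inter> (\<Inter>j<Suc n. {x. \<bar>x j - x0 j\<bar> < \<eta>})"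
  define U where "U = V \<inter> {x. \<forall>i\<ge>Suc n. x i = 0}"
  have "open V" unfolding V_def using \<open>finite D\<close>
    by (intro open_Int open_INT ballI open_Collect_less continuous_intros continuous_on_coordinate) auto
  then have "openin (Euclidean_space (Suc n)) U"
    unfolding Euclidean_space_def euclidean_product_topology openin_subtopology U_def by (auto simp flip: open_openin)
  moreover have "x0 \<in> U" using x0 eta by (auto simp: U_def V_def)
  moreover define f where "f x i = (if i < n then h i x else 0)" for x i
  moreover have "continuous_on U f"
  proof (rule continuous_on_coordinatewise_then_product)
    fix i show "continuous_on U (\<lambda>x. f x i)"
      by (cases "i < n") (auto simp: f_def intro: continuous_on_subset[OF h(1)])
  qed
  moreover have "inj_on f U"
  proof
    fix x y assume xy: "x \<in> U" "y \<in> U" "f x = f y"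
    have "u i (E x) = u i (E y)" if "i < n" for i
      using fun_cong[OF xy(3), of i] that h(2) by (simp add: f_def)
    then obtain \<sigma> where \<sigma>: "\<sigma> \<in> F" "\<And>j. j < Suc n \<Longrightarrow> E y (a j) = E x (\<sigma> j)"
      using sep[OF E E] by blast
    have dist: "\<bar>x l - y l\<bar> < 2 * \<eta>" if "l < Suc n" for l
    proof -
      have "\<bar>x l - x0 l\<bar> < \<eta>" "\<bar>y l - x0 l\<bar> < \<eta>" using xy(1,2) that unfolding U_def V_def by blast+
      then show ?thesis by linarith
    qed
    have per: "((\<Sum>j<Suc n. c \<sigma> l j * x j) + x l - y l) / (2 * pi) \<in> \<int>" if l: "l < Suc n" for l
    proof -
      have "(\<Sum>j<Suc n. x j * t j (\<sigma> l)) = (\<Sum>j<Suc n. c \<sigma> l j * x j + (if j = l then x j else 0))"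
        by (intro sum.cong) (auto simp: c_def algebra_simps)
      also have "\<dots> = (\<Sum>j<Suc n. c \<sigma> l j * x j) + x l"
      proof -
        have "(\<Sum>j<Suc n. if j = l then x j else 0) = x l" using l by (subst sum.delta) auto
        then show ?thesis by (simp only: sum.distrib)
      qed
      finally have "E x (\<sigma> l) = cis ((\<Sum>j<Suc n. c \<sigma> l j * x j) + x l)"
        using F[OF \<sigma>(1) l] by (simp only: E_def exp_char_apply)
      moreover have "E y (a l) = cis (y l)" unfolding E_def by (rule exp_char_dual_family[OF d l])
      ultimately show ?thesis using \<sigma>(2)[OF l] by (simp only: cis_eq_cis_iff)
    qed
    have small: "z = 0" if "z / (2 * pi) \<in> \<int>" "\<bar>z\<bar> < 2 * pi" for z
    proof -
      obtain k where k: "z / (2 * pi) = of_int k" using \<open>z / (2 * pi) \<in> \<int>\<close> by (auto elim: Ints_cases)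
      then have z: "z = 2 * pi * of_int k" by (simp add: field_simps)
      then have "\<bar>of_int k\<bar> < (1::real)" using \<open>\<bar>z\<bar> < 2 * pi\<close> by (simp add: abs_mult)
      then have "k = 0" by linarith
      then show ?thesis using z by simp
    qed
    have "c \<sigma> l j = 0" if lj: "l < Suc n" "j < Suc n" for l j
    proof (rule ccontr)
      assume nz: "c \<sigma> l j \<noteq> 0"
      have cD: "c \<sigma> l \<in> D" using \<sigma>(1) lj(1) by (auto simp: D_def)
      let ?A = "\<Sum>j<Suc n. c \<sigma> l j * x j" and ?B = "\<Sum>j<Suc n. c \<sigma> l j * x0 j"
      have B: "3 * \<eta> < \<bar>?B\<bar>" "\<bar>?B\<bar> + 3 * \<eta> < 2 * pi" using D[OF cD] nz lj(2) by blast+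
      have A: "\<bar>?A - ?B\<bar> < \<eta>" using xy(1) cD unfolding U_def V_def by blast
      \<comment> \<open>This quantity is a multiple of 2 pi by \<open>per\<close>. The upper margin
        makes it 0, and the lower margin makes that impossible.\<close>
      have "\<bar>?A + x l - y l\<bar> < 2 * pi" using A B(2) dist[OF lj(1)] by linarith
      then have "?A + x l - y l = 0" by (rule small[OF per[OF lj(1)]])
      then show False using A B(1) dist[OF lj(1)] by linarith
    qed
    then have "(x l - y l) / (2 * pi) \<in> \<int>" if "l < Suc n" for l
      using per[OF that] that by simp
    moreover have "\<bar>x l - y l\<bar> < 2 * pi" if "l < Suc n" for l
      using dist[OF that] eta pi_gt3 by linarith
    ultimately have "x l = y l" if "l < Suc n" for l
      using small[of "x l - y l"] that by simp
    moreover have "x l = y l" if "\<not> l < Suc n" for l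
      using xy(1,2) that by (simp add: U_def)
    ultimately show "x = y" by blast
  qed
  ultimately show False
    by (intro no_injection_lower_Euclidean_space[of n U x0 f]) (auto simp: f_def)
qed

section \<open>Characters of the function algebra of a torus\<close>

lemma cont_fun_torus_iff:
  "f \<in> cont_fun (torus n) \<longleftrightarrow> continuous_on ({..<n} \<rightarrow>\<^sub>E circle) f \<and> (\<forall>z. z \<notin> {..<n} \<rightarrow>\<^sub>E circle \<longrightarrow> f z = 0)"
  by (simp add: cont_fun_def torus_eq)

lemma cont_fun_torus_ops:
  assumes "f \<in> cont_fun (torus n)" "g \<in> cont_fun (torus n)"
  shows "(\<lambda>z. f z + g z) \<in> cont_fun (torus n)" "(\<lambda>z. f z * g z) \<in> cont_fun (torus n)"
    "(\<lambda>z. c * f z) \<in> cont_fun (torus n)" "(\<lambda>z. cnj (f z)) \<in> cont_fun (torus n)"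
  using assms by (auto simp: cont_fun_torus_iff intro!: continuous_intros)

lemma cont_fun_torus_extend:
  assumes "continuous_on ({..<n} \<rightarrow>\<^sub>E circle) f"
  shows "(\<lambda>z. if z \<in> {..<n} \<rightarrow>\<^sub>E circle then f z else 0) \<in> cont_fun (torus n)"
proof -
  have "continuous_on ({..<n} \<rightarrow>\<^sub>E circle) (\<lambda>z. if z \<in> {..<n} \<rightarrow>\<^sub>E circle then f z else 0)"
    by (rule continuous_on_eq[OF assms]) simp
  then show ?thesis by (simp add: cont_fun_torus_iff)
qed

text \<open>The function \<open>|h - \<Psi> h|\<^sup>2 + (\<Sum>i<n. |z\<^sub>i - \<Psi> z\<^sub>i|\<^sup>2)\<close> is killed by \<open>\<Psi>\<close>, so it is not invertible and
  vanishes somewhere; that zero can only be the point with coordinates \<open>\<Psi> z\<^sub>i\<close>.\<close>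

lemma star_iso_torus_character:
  fixes \<Psi> :: "((nat \<Rightarrow> complex) \<Rightarrow> complex) \<Rightarrow> complex" and n :: nat
    and T :: "((nat \<Rightarrow> complex) \<Rightarrow> complex) set" and I :: "(nat \<Rightarrow> complex) set"
    and unitf :: "(nat \<Rightarrow> complex) \<Rightarrow> complex" and z :: "nat \<Rightarrow> (nat \<Rightarrow> complex) \<Rightarrow> complex"
  defines "T \<equiv> cont_fun (torus n)" and "I \<equiv> {..<n} \<rightarrow>\<^sub>E circle"
  defines "unitf \<equiv> (\<lambda>z. if z \<in> I then 1 else 0)"
  defines "z \<equiv> (\<lambda>i x. if x \<in> I then x i else 0)"
  assumes add: "\<And>f g. f \<in> T \<Longrightarrow> g \<in> T \<Longrightarrow> \<Psi> (\<lambda>x. f x + g x) = \<Psi> f + \<Psi> g"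
    and mult: "\<And>f g. f \<in> T \<Longrightarrow> g \<in> T \<Longrightarrow> \<Psi> (\<lambda>x. f x * g x) = \<Psi> f * \<Psi> g"
    and scale: "\<And>c f. f \<in> T \<Longrightarrow> \<Psi> (\<lambda>x. c * f x) = c * \<Psi> f"
    and cnj: "\<And>f. f \<in> T \<Longrightarrow> \<Psi> (\<lambda>x. cnj (f x)) = cnj (\<Psi> f)"
    and unit: "\<Psi> unitf = 1"
    and h: "h \<in> T"
  shows "\<forall>i<n. norm (\<Psi> (z i)) = 1" and "\<Psi> h = h (\<lambda>i\<in>{..<n}. \<Psi> (z i))"
proof -
  have ext: "(\<lambda>x. if x \<in> I then f x else 0) \<in> T" if "continuous_on I f" for f
    using cont_fun_torus_extend[of n f] that by (simp add: T_def I_def)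
  have unitf: "unitf \<in> T" unfolding unitf_def by (rule ext) simp
  have zT: "z i \<in> T" for i unfolding z_def by (rule ext) (rule continuous_on_coordinate)
  note ops = cont_fun_torus_ops[where n = n, folded T_def]
  show norm: "\<forall>i<n. norm (\<Psi> (z i)) = 1"
  proof (intro allI impI)
    fix i assume i: "i < n"
    have "(\<lambda>x. z i x * cnj (z i x)) = unitf"
      using i by (auto simp: z_def unitf_def I_def circle_def PiE_def Pi_def complex_norm_square[symmetric] fun_eq_iff)
    then have "\<Psi> (z i) * cnj (\<Psi> (z i)) = 1"
      using mult[OF zT[of i] ops(4)[OF zT[of i] zT[of i]]] cnj[OF zT[of i]] unit by simp
    then have "complex_of_real ((norm (\<Psi> (z i)))\<^sup>2) = of_real 1"
      unfolding complex_norm_square by simp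
    then have "(norm (\<Psi> (z i)))\<^sup>2 = 1\<^sup>2" by (simp only: of_real_eq_iff) simp
    then show "norm (\<Psi> (z i)) = 1" by (rule power2_eq_imp_eq) simp_all
  qed
  define p where "p = (\<lambda>i\<in>{..<n}. \<Psi> (z i))"
  have pI: "p \<in> I" using norm by (auto simp: p_def I_def circle_def)
  \<comment> \<open>Members of T vanish off I, so the constant c must be subtracted as a multiple of
    the unit of T and not as a constant function.\<close>
  define sub where "sub f c = (\<lambda>x. f x + (- c) * unitf x)" for f :: "(nat \<Rightarrow> complex) \<Rightarrow> complex" and c
  have subT: "sub f c \<in> T" if "f \<in> T" for f c
    unfolding sub_def using ops(1)[OF that ops(3)[OF unitf unitf, of "- c"]] .
  have \<Psi>sub: "\<Psi> (sub f c) = \<Psi> f - c" if "f \<in> T" for f c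
    unfolding sub_def using add[OF that ops(3)[OF unitf unitf, of "- c"]] scale[OF unitf, of "- c"] unit by simp
  have sq: "\<Psi> (\<lambda>x. f x * cnj (f x)) = 0" "(\<lambda>x. f x * cnj (f x)) \<in> T" if "f \<in> T" "\<Psi> f = 0" for f
    using mult[OF that(1) ops(4)[OF that(1,1)]] ops(2)[OF that(1) ops(4)[OF that(1,1)]] that(2) by auto
  define w where "w i = sub (z i) (p i)" for i
  define e where "e = sub h (\<Psi> h)"
  define g where "g m = (\<lambda>x. e x * cnj (e x) + (\<Sum>i<m. w i x * cnj (w i x)))" for m :: nat
  have w: "w i \<in> T" "\<Psi> (w i) = 0" if "i < n" for i
    using subT[OF zT] \<Psi>sub[OF zT] that by (auto simp: w_def p_def)
  have e: "e \<in> T" "\<Psi> e = 0" using subT[OF h] \<Psi>sub[OF h] by (auto simp: e_def)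
  have g: "g m \<in> T \<and> \<Psi> (g m) = 0" if "m \<le> n" for m
    using that
  proof (induction m)
    case 0
    then show ?case using sq[OF e] by (simp add: g_def)
  next
    case (Suc m)
    have "g (Suc m) = (\<lambda>x. g m x + w m x * cnj (w m x))" by (simp add: g_def add.assoc)
    then show ?case using Suc add[of "g m"] ops(1)[of "g m"] sq[OF w, of m] by simp
  qed
  show "\<Psi> h = h (\<lambda>i\<in>{..<n}. \<Psi> (z i))"
  proof (rule ccontr)
    assume neq: "\<Psi> h \<noteq> h (\<lambda>i\<in>{..<n}. \<Psi> (z i))"
    have nz: "g n x \<noteq> 0" if x: "x \<in> I" for x
    proof
      assume "g n x = 0"
      then have "complex_of_real ((norm (e x))\<^sup>2 + (\<Sum>i<n. (norm (w i x))\<^sup>2)) = of_real 0"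
        by (simp only: of_real_add of_real_sum complex_norm_square) (simp add: g_def)
      then have 0: "(norm (e x))\<^sup>2 + (\<Sum>i<n. (norm (w i x))\<^sup>2) = 0" by (simp only: of_real_eq_iff)
      moreover have s: "(\<Sum>i<n. (norm (w i x))\<^sup>2) \<ge> 0" by (intro sum_nonneg) simp
      ultimately have ex: "e x = 0" and "(\<Sum>i<n. (norm (w i x))\<^sup>2) = 0"
        using zero_le_power2[of "norm (e x)"] by (smt (verit) norm_eq_zero zero_eq_power2)+
      then have "\<forall>i\<in>{..<n}. (norm (w i x))\<^sup>2 = 0" by (subst (asm) sum_nonneg_eq_0_iff) auto
      then have "x i = p i" if "i < n" for i
        using that x by (simp add: w_def sub_def z_def unitf_def)
      then have "x = p" using x pI unfolding I_def by (intro PiE_ext) auto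
      then have "e p = 0" using ex by simp
      then show False using neq pI by (simp add: e_def sub_def unitf_def p_def)
    qed
    define k where "k x = (if x \<in> I then 1 / g n x else 0)" for x
    have "continuous_on I (g n)" using g[of n] by (simp add: T_def I_def cont_fun_torus_iff)
    then have "k \<in> T" unfolding k_def using nz by (intro ext continuous_intros) auto
    moreover have "(\<lambda>x. g n x * k x) = unitf" using nz by (auto simp: k_def unitf_def)
    ultimately show False using mult[of "g n" k] g[of n] unit by simp
  qed
qed

text \<open>The inverse isomorphism followed by evaluation at a point of \<open>X\<close> is a
  character of the torus algebra. By \<open>star_iso_torus_character\<close> it is evaluation at a
  torus point, whose coordinates are the values of the transported coordinate functions
  \<open>u i\<close>.\<close>

lemma star_iso_torus_pullback:
  fixes S :: "('x \<Rightarrow> complex) set" and n :: nat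
  assumes iso: "star_iso \<Phi> S (cont_fun (torus n))"
    and add: "\<And>f g. f \<in> S \<Longrightarrow> g \<in> S \<Longrightarrow> (\<lambda>x. f x + g x) \<in> S"
    and mult: "\<And>f g. f \<in> S \<Longrightarrow> g \<in> S \<Longrightarrow> (\<lambda>x. f x * g x) \<in> S"
    and scale: "\<And>c f. f \<in> S \<Longrightarrow> (\<lambda>x. c * f x) \<in> S"
    and cnj: "\<And>f. f \<in> S \<Longrightarrow> (\<lambda>x. cnj (f x)) \<in> S"
    and unit: "(\<lambda>x. if x \<in> X then 1 else 0) \<in> S"
    and supp: "\<And>f x. f \<in> S \<Longrightarrow> x \<notin> X \<Longrightarrow> f x = 0"
  shows "\<exists>u. (\<forall>i<n. u i \<in> S \<and> (\<forall>x\<in>X. norm (u i x) = 1)) \<and>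
    (\<forall>f\<in>S. \<forall>x\<in>X. f x = \<Phi> f (\<lambda>i\<in>{..<n}. u i x))"
proof -
  define T where "T = cont_fun (torus n)"
  define I where "I = {..<n} \<rightarrow>\<^sub>E circle"
  define oneT where "oneT = (\<lambda>z. if z \<in> I then 1 else 0 :: complex)"
  define oneS where "oneS = (\<lambda>x. if x \<in> X then 1 else 0 :: complex)"
  have bij: "bij_betw \<Phi> S T" using iso by (simp add: star_iso_def T_def)
  define \<Psi> where "\<Psi> = inv_into S \<Phi>"
  have \<Psi>S: "\<Psi> h \<in> S" if "h \<in> T" for h
    using bij that by (metis \<Psi>_def bij_betw_imp_surj_on inv_into_into)
  have \<Phi>\<Psi>: "\<Phi> (\<Psi> h) = h" if "h \<in> T" for h
    using bij that by (metis \<Psi>_def bij_betw_inv_into_right)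
  have \<Phi>T: "\<Phi> f \<in> T" if "f \<in> S" for f using bij that by (rule bij_betwE[rule_format])
  have \<Psi>\<Phi>: "\<Psi> (\<Phi> f) = f" if "f \<in> S" for f
    using bij that by (metis \<Psi>_def bij_betw_inv_into_left)
  have \<Phi>_ops: "\<And>f g. f \<in> S \<Longrightarrow> g \<in> S \<Longrightarrow> \<Phi> (\<lambda>x. f x + g x) = (\<lambda>y. \<Phi> f y + \<Phi> g y)"
    "\<And>f g. f \<in> S \<Longrightarrow> g \<in> S \<Longrightarrow> \<Phi> (\<lambda>x. f x * g x) = (\<lambda>y. \<Phi> f y * \<Phi> g y)"
    "\<And>c f. f \<in> S \<Longrightarrow> \<Phi> (\<lambda>x. c * f x) = (\<lambda>y. c * \<Phi> f y)"
    "\<And>f. f \<in> S \<Longrightarrow> \<Phi> (\<lambda>x. cnj (f x)) = (\<lambda>y. cnj (\<Phi> f y))"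
    using iso by (simp_all add: star_iso_def)
  have eqI: "\<Psi> h = f" if "f \<in> S" "\<Phi> f = h" for f h
    using \<Psi>\<Phi>[OF that(1)] that(2) by simp
  have \<Psi>_ops: "\<And>f g. f \<in> T \<Longrightarrow> g \<in> T \<Longrightarrow> \<Psi> (\<lambda>x. f x + g x) = (\<lambda>y. \<Psi> f y + \<Psi> g y)"
    "\<And>f g. f \<in> T \<Longrightarrow> g \<in> T \<Longrightarrow> \<Psi> (\<lambda>x. f x * g x) = (\<lambda>y. \<Psi> f y * \<Psi> g y)"
    "\<And>c f. f \<in> T \<Longrightarrow> \<Psi> (\<lambda>x. c * f x) = (\<lambda>y. c * \<Psi> f y)"
    "\<And>f. f \<in> T \<Longrightarrow> \<Psi> (\<lambda>x. cnj (f x)) = (\<lambda>y. cnj (\<Psi> f y))"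
    by (rule eqI; simp add: add mult scale cnj \<Psi>S \<Phi>_ops \<Phi>\<Psi>)+
  have oneT: "oneT \<in> T" unfolding oneT_def T_def I_def by (rule cont_fun_torus_extend) simp
  have oneS: "oneS \<in> S" using unit by (simp add: oneS_def)
  have "\<Psi> oneT = oneS"
  proof (rule eqI[OF oneS])
    \<comment> \<open>\<open>star_iso\<close> does not mention units, so preservation is derived:
      each of the two units absorbs the image of the other.\<close>
    have "\<Phi> oneS = (\<lambda>y. \<Phi> oneS y * oneT y)"
      using \<Phi>T[OF oneS] by (auto simp: T_def I_def oneT_def cont_fun_torus_iff fun_eq_iff)
    also have "\<dots> = \<Phi> (\<lambda>x. oneS x * \<Psi> oneT x)"
      by (simp add: \<Phi>_ops(2)[OF oneS \<Psi>S[OF oneT]] \<Phi>\<Psi>[OF oneT])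
    also have "(\<lambda>x. oneS x * \<Psi> oneT x) = \<Psi> oneT"
      using supp[OF \<Psi>S[OF oneT]] by (auto simp: oneS_def fun_eq_iff)
    finally show "\<Phi> oneS = oneT" by (simp add: \<Phi>\<Psi>[OF oneT])
  qed
  define z where "z = (\<lambda>i x. if x \<in> I then x i else 0 :: complex)"
  have zT: "z i \<in> T" for i
    unfolding z_def T_def I_def by (rule cont_fun_torus_extend) (rule continuous_on_coordinate)
  have key: "(\<forall>i<n. norm (\<Psi> (z i) x) = 1) \<and> \<Psi> h x = h (\<lambda>i\<in>{..<n}. \<Psi> (z i) x)" if x: "x \<in> X" and h: "h \<in> T" for x h
  proof -
    have "(\<lambda>f. \<Psi> f x) oneT = 1" using \<open>\<Psi> oneT = oneS\<close> x by (simp add: oneS_def)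
    with star_iso_torus_character[where \<Psi> = "\<lambda>f. \<Psi> f x" and n = n and h = h, folded T_def I_def, folded oneT_def z_def]
    show ?thesis using \<Psi>_ops h by (auto simp: oneT_def z_def)
  qed
  show ?thesis
  proof (intro exI[of _ "\<lambda>i. \<Psi> (z i)"] conjI allI impI ballI)
    show "\<Psi> (z i) \<in> S" for i by (rule \<Psi>S[OF zT])
    show "norm (\<Psi> (z i) x) = 1" if "i < n" "x \<in> X" for i x using key[OF that(2) oneT] that(1) by blast
    show "f x = \<Phi> f (\<lambda>i\<in>{..<n}. \<Psi> (z i) x)" if "f \<in> S" "x \<in> X" for f x
      using key[OF that(2) \<Phi>T[OF that(1)]] \<Psi>\<Phi>[OF that(1)] by simp
  qed
qed

section \<open>The fixed point algebra\<close>

locale finite_orbit_action = A: comm_group A + act: group_action G "carrier A" \<phi>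
  for A :: "('a, 'b) monoid_scheme" and G :: "('g, 'c) monoid_scheme" and \<phi> :: "'g \<Rightarrow> 'a \<Rightarrow> 'a" +
  assumes torsion_free: "torsion_free A"
    and act_hom: "g \<in> carrier G \<Longrightarrow> \<phi> g \<in> hom A A"
    and finite_orbit: "a \<in> carrier A \<Longrightarrow> finite (orbit G \<phi> a)"
begin

lemma group_G: "group G"
  using act.group_hom by (rule group_hom.axioms)

lemma act_closed: "g \<in> carrier G \<Longrightarrow> a \<in> carrier A \<Longrightarrow> \<phi> g a \<in> carrier A"
  using act.element_image by blast

lemma act_one: "a \<in> carrier A \<Longrightarrow> \<phi> \<one>\<^bsub>G\<^esub> a = a"
  by (metis act.id_eq_one restrict_apply')

lemma act_inv: "g \<in> carrier G \<Longrightarrow> a \<in> carrier A \<Longrightarrow> \<phi> g (\<phi> (inv\<^bsub>G\<^esub> g) a) = a"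
  using act.composition_rule[of a g "inv\<^bsub>G\<^esub> g"] group.r_inv[OF group_G] group.inv_closed[OF group_G] act_one by simp

lemma dual_action_apply: "a \<in> carrier A \<Longrightarrow> dual_action A (\<phi> g) \<gamma> a = \<gamma> (\<phi> g a)"
  by (simp add: dual_action_def)

lemma dual_action_closed:
  assumes "g \<in> carrier G" "\<gamma> \<in> characters A"
  shows "dual_action A (\<phi> g) \<gamma> \<in> characters A"
proof -
  have "\<phi> g (x \<otimes>\<^bsub>A\<^esub> y) = \<phi> g x \<otimes>\<^bsub>A\<^esub> \<phi> g y" if "x \<in> carrier A" "y \<in> carrier A" for x y
    using act_hom[OF assms(1)] that by (rule hom_mult)
  then show ?thesis
    using charactersD[OF assms(2)] act_closed[OF assms(1)]
    by (auto simp: characters_def dual_action_def circle_def)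
qed

lemma continuous_on_dual_action: "continuous_on (characters A) (dual_action A (\<phi> g))"
proof (rule continuous_on_coordinatewise_then_product)
  fix a show "continuous_on (characters A) (\<lambda>\<gamma>. dual_action A (\<phi> g) \<gamma> a)"
    by (cases "a \<in> carrier A") (simp_all add: dual_action_def continuous_on_coordinate)
qed

lemma fixed_point_algebra_iff:
  "f \<in> fixed_point_algebra G A \<phi> \<longleftrightarrow> continuous_on (characters A) f \<and> (\<forall>\<gamma>. \<gamma> \<notin> characters A \<longrightarrow> f \<gamma> = 0) \<and>
    (\<forall>g\<in>carrier G. \<forall>\<gamma>\<in>characters A. f (dual_action A (\<phi> g) \<gamma>) = f \<gamma>)"
  by (simp add: fixed_point_algebra_def cont_fun_def pontryagin_dual_eq)

lemma fixed_point_algebra_extend: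
  assumes "continuous_on (characters A) f"
    and "\<And>g \<gamma>. g \<in> carrier G \<Longrightarrow> \<gamma> \<in> characters A \<Longrightarrow> f (dual_action A (\<phi> g) \<gamma>) = f \<gamma>"
  shows "(\<lambda>\<gamma>. if \<gamma> \<in> characters A then f \<gamma> else 0) \<in> fixed_point_algebra G A \<phi>"
proof -
  have "continuous_on (characters A) (\<lambda>\<gamma>. if \<gamma> \<in> characters A then f \<gamma> else 0)"
    by (rule continuous_on_eq[OF assms(1)]) simp
  then show ?thesis using assms(2) dual_action_closed by (simp add: fixed_point_algebra_iff)
qed

lemma fixed_point_algebra_separates:
  assumes S: "finite S" "S \<subseteq> carrier A" and \<gamma>: "\<gamma> \<in> characters A" and \<delta>: "\<delta> \<in> characters A"
    and eq: "\<And>f. f \<in> fixed_point_algebra G A \<phi> \<Longrightarrow> f \<gamma> = f \<delta>"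
  shows "\<exists>g\<in>carrier G. \<forall>s\<in>S. \<delta> s = \<gamma> (\<phi> g s)"
proof -
  \<comment> \<open>The product over all restrictions \<open>\<sigma>\<close> of \<open>G\<close> to \<open>S\<close> of the squared distance between \<open>\<epsilon> \<circ> \<sigma>\<close> and \<open>\<delta>\<close>
    is an invariant function of \<open>\<epsilon>\<close> that vanishes at \<open>\<delta>\<close>, hence at \<open>\<gamma>\<close>.\<close>
  define F where "F = (\<lambda>g. restrict (\<phi> g) S) ` carrier G"
  have "F \<subseteq> (\<Pi>\<^sub>E s\<in>S. orbit G \<phi> s)" by (auto simp: F_def orbit_def)
  moreover have "finite (\<Pi>\<^sub>E s\<in>S. orbit G \<phi> s)"
    using S finite_orbit by (intro finite_PiE) auto
  ultimately have fin: "finite F" by (rule finite_subset)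
  define q where "q \<epsilon> \<sigma> = (\<Sum>s\<in>S. (norm (\<epsilon> (\<sigma> s) - \<delta> s))\<^sup>2)" for \<epsilon> :: "'a \<Rightarrow> complex" and \<sigma>
  define f where "f \<epsilon> = complex_of_real (\<Prod>\<sigma>\<in>F. q \<epsilon> \<sigma>)" for \<epsilon>
  have "continuous_on (characters A) f"
    unfolding f_def q_def by (intro continuous_intros continuous_on_coordinate)
  moreover have "f (dual_action A (\<phi> g) \<epsilon>) = f \<epsilon>" if g: "g \<in> carrier G" and \<epsilon>: "\<epsilon> \<in> characters A" for g \<epsilon>
  proof -
    have ig: "inv\<^bsub>G\<^esub> g \<in> carrier G" using g by (rule group.inv_closed[OF group_G])
    have comp: "restrict (\<phi> h \<circ> \<sigma>) S \<in> F" if "\<sigma> \<in> F" "h \<in> carrier G" for \<sigma> h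
    proof -
      obtain g' where g': "g' \<in> carrier G" "\<sigma> = restrict (\<phi> g') S" using \<open>\<sigma> \<in> F\<close> by (auto simp: F_def)
      have "restrict (\<phi> h \<circ> \<sigma>) S = restrict (\<phi> (h \<otimes>\<^bsub>G\<^esub> g')) S"
      proof
        fix s show "restrict (\<phi> h \<circ> \<sigma>) S s = restrict (\<phi> (h \<otimes>\<^bsub>G\<^esub> g')) S s"
          using act.composition_rule[OF _ that(2) g'(1), of s] S(2) by (cases "s \<in> S") (auto simp: g'(2))
      qed
      moreover have "h \<otimes>\<^bsub>G\<^esub> g' \<in> carrier G"
        using group.is_monoid[OF group_G] that(2) g'(1) by (rule monoid.m_closed)
      ultimately show ?thesis by (auto simp: F_def)
    qed
    have Fc: "\<sigma> s \<in> carrier A" "\<sigma> \<in> extensional S" if "\<sigma> \<in> F" "s \<in> S" for \<sigma> s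
      using that S(2) act_closed by (auto simp: F_def)
    have ext: "\<sigma> \<in> extensional S" if "\<sigma> \<in> F" for \<sigma> using that by (auto simp: F_def)
    have canc: "restrict (\<phi> h \<circ> restrict (\<phi> (inv\<^bsub>G\<^esub> h) \<circ> \<sigma>) S) S = \<sigma>" if "\<sigma> \<in> F" "h \<in> carrier G" for \<sigma> h
      by (rule extensionalityI[of _ S]) (use that ext Fc act_inv in auto)
    \<comment> \<open>Acting by g amounts to composing the members of F with \<phi> g, which
      permutes F; the factors of the product are only rearranged.\<close>
    have "(\<Prod>\<sigma>\<in>F. q (dual_action A (\<phi> g) \<epsilon>) \<sigma>) = (\<Prod>\<sigma>\<in>F. q \<epsilon> \<sigma>)"
    proof (rule prod.reindex_bij_witness[where j = "\<lambda>\<sigma>. restrict (\<phi> g \<circ> \<sigma>) S" and i = "\<lambda>\<sigma>. restrict (\<phi> (inv\<^bsub>G\<^esub> g) \<circ> \<sigma>) S"])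
      fix \<sigma> assume \<sigma>: "\<sigma> \<in> F"
      show "restrict (\<phi> (inv\<^bsub>G\<^esub> g) \<circ> restrict (\<phi> g \<circ> \<sigma>) S) S = \<sigma>"
        using canc[OF \<sigma> ig] group.inv_inv[OF group_G g] by simp
      show "restrict (\<phi> g \<circ> \<sigma>) S \<in> F" "restrict (\<phi> (inv\<^bsub>G\<^esub> g) \<circ> \<sigma>) S \<in> F"
        using comp \<sigma> g ig by auto
      show "restrict (\<phi> g \<circ> restrict (\<phi> (inv\<^bsub>G\<^esub> g) \<circ> \<sigma>) S) S = \<sigma>" using canc[OF \<sigma> g] .
      show "q \<epsilon> (restrict (\<phi> g \<circ> \<sigma>) S) = q (dual_action A (\<phi> g) \<epsilon>) \<sigma>"
        using Fc[OF \<sigma>] by (simp add: q_def dual_action_apply)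
    qed
    then show ?thesis by (simp only: f_def)
  qed
  ultimately have "(\<lambda>\<epsilon>. if \<epsilon> \<in> characters A then f \<epsilon> else 0) \<in> fixed_point_algebra G A \<phi>"
    by (rule fixed_point_algebra_extend)
  from eq[OF this] have "f \<gamma> = f \<delta>" using \<gamma> \<delta> by simp
  also have "f \<delta> = 0"
  proof -
    have "restrict (\<phi> \<one>\<^bsub>G\<^esub>) S \<in> F"
      using monoid.one_closed[OF group.is_monoid[OF group_G]] by (auto simp: F_def)
    moreover have "q \<delta> (restrict (\<phi> \<one>\<^bsub>G\<^esub>) S) = 0"
      unfolding q_def by (rule sum.neutral) (use S(2) act_one in auto)
    ultimately show ?thesis unfolding f_def using fin by (auto simp: prod_zero_iff)
  qed
  finally have "(\<Prod>\<sigma>\<in>F. q \<gamma> \<sigma>) = 0" by (simp only: f_def of_real_eq_0_iff)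
  then obtain \<sigma> where "\<sigma> \<in> F" "q \<gamma> \<sigma> = 0" using fin by (auto simp: prod_zero_iff)
  then obtain g where g: "g \<in> carrier G" "q \<gamma> (restrict (\<phi> g) S) = 0" by (auto simp: F_def)
  have "\<forall>s\<in>S. (norm (\<gamma> (restrict (\<phi> g) S s) - \<delta> s))\<^sup>2 = 0"
    using g(2) S(1) unfolding q_def by (subst (asm) sum_nonneg_eq_0_iff) auto
  then show ?thesis using g(1) by (intro bexI[of _ g]) auto
qed

end

section \<open>The map from the dual to the torus\<close>

locale torus_fixed_points = finite_orbit_action A G \<phi>
  for A :: "('a, 'b) monoid_scheme" and G :: "('g, 'c) monoid_scheme" and \<phi> :: "'g \<Rightarrow> 'a \<Rightarrow> 'a" +
  fixes n :: nat and u :: "nat \<Rightarrow> ('a \<Rightarrow> complex) \<Rightarrow> complex"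
    and \<Phi> :: "(('a \<Rightarrow> complex) \<Rightarrow> complex) \<Rightarrow> (nat \<Rightarrow> complex) \<Rightarrow> complex"
  assumes \<Phi>_bij: "bij_betw \<Phi> (fixed_point_algebra G A \<phi>) (cont_fun (torus n))"
    and u_fixed: "i < n \<Longrightarrow> u i \<in> fixed_point_algebra G A \<phi>"
    and u_norm: "i < n \<Longrightarrow> \<gamma> \<in> characters A \<Longrightarrow> norm (u i \<gamma>) = 1"
    and pullback: "f \<in> fixed_point_algebra G A \<phi> \<Longrightarrow> \<gamma> \<in> characters A \<Longrightarrow> f \<gamma> = \<Phi> f (\<lambda>i\<in>{..<n}. u i \<gamma>)"
begin

text \<open>In the application \<open>u i\<close> is the function sent by \<Phi> to the i-th torus
  coordinate. Thus \<open>proj\<close> is the map of spaces behind the isomorphism, and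
  \<open>pullback\<close> says that composition with it undoes \<Phi>.\<close>

definition proj :: "('a \<Rightarrow> complex) \<Rightarrow> nat \<Rightarrow> complex" where
  "proj \<gamma> = (\<lambda>i\<in>{..<n}. u i \<gamma>)"

lemma u_continuous: "i < n \<Longrightarrow> continuous_on (characters A) (u i)"
  using u_fixed by (simp add: fixed_point_algebra_iff)

lemma u_invariant: "i < n \<Longrightarrow> g \<in> carrier G \<Longrightarrow> \<gamma> \<in> characters A \<Longrightarrow> u i (dual_action A (\<phi> g) \<gamma>) = u i \<gamma>"
  using u_fixed by (simp add: fixed_point_algebra_iff)

lemma proj_in: "\<gamma> \<in> characters A \<Longrightarrow> proj \<gamma> \<in> {..<n} \<rightarrow>\<^sub>E circle"
  using u_norm by (auto simp: proj_def circle_def)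

lemma continuous_on_proj: "continuous_on (characters A) proj"
proof (rule continuous_on_coordinatewise_then_product)
  fix i show "continuous_on (characters A) (\<lambda>\<gamma>. proj \<gamma> i)"
    by (cases "i < n") (simp_all add: proj_def u_continuous)
qed

lemma fixed_point_descends:
  assumes "f \<in> fixed_point_algebra G A \<phi>"
  obtains k where "continuous_on ({..<n} \<rightarrow>\<^sub>E circle) k" "\<And>\<gamma>. \<gamma> \<in> characters A \<Longrightarrow> f \<gamma> = k (proj \<gamma>)"
proof
  have "\<Phi> f \<in> cont_fun (torus n)" using \<Phi>_bij assms by (rule bij_betwE[rule_format])
  then show "continuous_on ({..<n} \<rightarrow>\<^sub>E circle) (\<Phi> f)" by (simp add: cont_fun_torus_iff)
  show "f \<gamma> = \<Phi> f (proj \<gamma>)" if "\<gamma> \<in> characters A" for \<gamma>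
    unfolding proj_def using assms that by (rule pullback)
qed

text \<open>This takes the place of surjectivity of \<open>proj\<close>. Both functions, cut off
  outside the torus, are images under \<Phi>; their preimages agree on all characters and are
  therefore the same function.\<close>

lemma torus_functions_eqI:
  fixes k k' :: "(nat \<Rightarrow> complex) \<Rightarrow> complex"
  assumes k: "continuous_on ({..<n} \<rightarrow>\<^sub>E circle) k" "continuous_on ({..<n} \<rightarrow>\<^sub>E circle) k'"
    and eq: "\<And>\<gamma>. \<gamma> \<in> characters A \<Longrightarrow> k (proj \<gamma>) = k' (proj \<gamma>)" and z: "z \<in> {..<n} \<rightarrow>\<^sub>E circle"
  shows "k z = k' z"
proof -
  have surj: "\<exists>f\<in>fixed_point_algebra G A \<phi>. \<Phi> f = h" if "h \<in> cont_fun (torus n)" for h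
    using \<Phi>_bij that by (metis bij_betw_imp_surj_on imageE)
  define e where "e h = (\<lambda>z. if z \<in> {..<n} \<rightarrow>\<^sub>E circle then h z else 0)" for h :: "(nat \<Rightarrow> complex) \<Rightarrow> complex"
  obtain f where f: "f \<in> fixed_point_algebra G A \<phi>" "\<Phi> f = e k"
    using surj[OF cont_fun_torus_extend[OF k(1)]] unfolding e_def by blast
  obtain f' where f': "f' \<in> fixed_point_algebra G A \<phi>" "\<Phi> f' = e k'"
    using surj[OF cont_fun_torus_extend[OF k(2)]] unfolding e_def by blast
  have "f \<gamma> = f' \<gamma>" for \<gamma>
  proof (cases "\<gamma> \<in> characters A")
    case True
    then have "f \<gamma> = e k (proj \<gamma>)" "f' \<gamma> = e k' (proj \<gamma>)"
      using pullback[OF f(1)] pullback[OF f'(1)] f(2) f'(2) by (simp_all add: proj_def)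
    then show ?thesis using eq[OF True] by (simp add: e_def)
  next
    case False
    then show ?thesis using f(1) f'(1) by (simp add: fixed_point_algebra_iff)
  qed
  then have "f = f'" by blast
  then have "e k = e k'" using f(2) f'(2) by simp
  then show ?thesis using z unfolding e_def by metis
qed

text \<open>Uniqueness of the group element in \<open>circle_map_factor\<close>: apply
  \<open>evaluation_not_exp\<close> to the quotient of \<open>a\<close> and
  \<open>b\<close>.\<close>

lemma character_eqI:
  assumes "a \<in> carrier A" "b \<in> carrier A" "continuous_on (characters A) k"
    and "\<And>\<gamma>. \<gamma> \<in> characters A \<Longrightarrow> \<gamma> a = \<gamma> b * cis (k \<gamma>)"
  shows "a = b"
proof -
  have "a \<otimes>\<^bsub>A\<^esub> inv\<^bsub>A\<^esub> b = \<one>\<^bsub>A\<^esub>"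
  proof (rule A.evaluation_not_exp[OF torsion_free _ assms(3)])
    fix \<gamma> assume \<gamma>: "\<gamma> \<in> characters A"
    have "\<gamma> (a \<otimes>\<^bsub>A\<^esub> inv\<^bsub>A\<^esub> b) = \<gamma> a * inverse (\<gamma> b)"
      using charactersD(1)[OF \<gamma>] A.char_inv[OF \<gamma>] assms(1,2) by simp
    also have "\<dots> = cis (k \<gamma>)"
      using assms(4)[OF \<gamma>] charactersD(3)[OF \<gamma> assms(2)] by simp
    finally show "\<gamma> (a \<otimes>\<^bsub>A\<^esub> inv\<^bsub>A\<^esub> b) = cis (k \<gamma>)" .
  qed (use assms in auto)
  then show ?thesis using assms(1,2) A.inv_solve_right' by (metis A.l_one A.one_closed)
qed

text \<open>Acting on the factorisation of the invariant function \<open>u i\<close> gives another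
  one, with \<phi> g (b i) in place of b i; uniqueness identifies the two elements.\<close>

lemma coordinate_factorization:
  obtains b k where "\<And>i. i < n \<Longrightarrow> b i \<in> carrier A" "\<And>i. i < n \<Longrightarrow> continuous_on (characters A) (k i)"
    "\<And>i \<gamma>. i < n \<Longrightarrow> \<gamma> \<in> characters A \<Longrightarrow> u i \<gamma> = \<gamma> (b i) * cis (k i \<gamma>)"
    "\<And>i g. i < n \<Longrightarrow> g \<in> carrier G \<Longrightarrow> \<phi> g (b i) = b i"
proof -
  have "\<exists>b k. b \<in> carrier A \<and> continuous_on (characters A) k \<and> (\<forall>\<gamma>\<in>characters A. u i \<gamma> = \<gamma> b * cis (k \<gamma>))" if "i < n" for i
    using A.circle_map_factor[OF torsion_free u_continuous[OF that] u_norm[OF that]] .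
  then obtain b k where bk: "\<And>i. i < n \<Longrightarrow> b i \<in> carrier A \<and> continuous_on (characters A) (k i) \<and>
      (\<forall>\<gamma>\<in>characters A. u i \<gamma> = \<gamma> (b i) * cis (k i \<gamma>))" by metis
  have "\<phi> g (b i) = b i" if i: "i < n" and g: "g \<in> carrier G" for i g
  proof (rule character_eqI)
    have b: "b i \<in> carrier A" and k: "continuous_on (characters A) (k i)" using bk[OF i] by auto
    then show "\<phi> g (b i) \<in> carrier A" "b i \<in> carrier A" using act_closed[OF g] by auto
    have "continuous_on (characters A) (\<lambda>\<gamma>. k i (dual_action A (\<phi> g) \<gamma>))"
      using dual_action_closed[OF g] by (intro continuous_on_compose2[OF k continuous_on_dual_action]) auto
    then show "continuous_on (characters A) (\<lambda>\<gamma>. k i \<gamma> - k i (dual_action A (\<phi> g) \<gamma>))"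
      using k by (intro continuous_intros)
    fix \<gamma> assume \<gamma>: "\<gamma> \<in> characters A"
    have "\<gamma> (\<phi> g (b i)) * cis (k i (dual_action A (\<phi> g) \<gamma>)) = \<gamma> (b i) * cis (k i \<gamma>)"
      using u_invariant[OF i g \<gamma>] bk[OF i] dual_action_closed[OF g \<gamma>] \<gamma> b by (simp add: dual_action_apply)
    then show "\<gamma> (\<phi> g (b i)) = \<gamma> (b i) * cis (k i \<gamma> - k i (dual_action A (\<phi> g) \<gamma>))"
      by (simp flip: cis_divide add: field_simps)
  qed
  then show thesis using that[of b k] bk by blast
qed

section \<open>The basis of fixed elements obtained from the torus coordinates\<close>

context
  fixes b :: "nat \<Rightarrow> 'a" and k :: "nat \<Rightarrow> ('a \<Rightarrow> complex) \<Rightarrow> real"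
  assumes b: "\<And>i. i < n \<Longrightarrow> b i \<in> carrier A" and k: "\<And>i. i < n \<Longrightarrow> continuous_on (characters A) (k i)"
    and ubk: "\<And>i \<gamma>. i < n \<Longrightarrow> \<gamma> \<in> characters A \<Longrightarrow> u i \<gamma> = \<gamma> (b i) * cis (k i \<gamma>)"
begin

lemma continuous_on_k_sum: "continuous_on (characters A) (\<lambda>\<gamma>. \<Sum>i<n. of_int (c i) * k i \<gamma>)"
  using k by (intro continuous_intros) auto

lemma prod_u:
  assumes "\<gamma> \<in> characters A"
  shows "(\<Prod>i<n. u i \<gamma> powi c i) = \<gamma> (lincomb A b n c) * cis (\<Sum>i<n. of_int (c i) * k i \<gamma>)"
proof -
  have "(\<Prod>i<n. u i \<gamma> powi c i) = (\<Prod>i<n. \<gamma> (b i) powi c i * cis (of_int (c i) * k i \<gamma>))"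
    using ubk[OF _ assms] by (intro prod.cong) (auto simp: power_int_mult_distrib cis_power_int)
  then show ?thesis using A.char_lincomb[OF assms b] by (simp add: prod.distrib cis_sum)
qed

text \<open>Evaluation at a fixed element is invariant, so it descends to a function on the torus,
  again of modulus 1. There it is a monomial times an exponential; pulled back, the exponents of the
  monomial express \<open>a\<close> through the \<open>b i\<close>.\<close>

lemma fixed_in_span:
  assumes a: "a \<in> carrier A" and fix_a: "\<And>g. g \<in> carrier G \<Longrightarrow> \<phi> g a = a"
  shows "a \<in> range (lincomb A b n)"
proof -
  have "(\<lambda>\<gamma>. if \<gamma> \<in> characters A then \<gamma> a else 0) \<in> fixed_point_algebra G A \<phi>"
    by (rule fixed_point_algebra_extend) (simp_all add: continuous_on_coordinate dual_action_apply a fix_a)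
  then obtain f where f: "continuous_on ({..<n} \<rightarrow>\<^sub>E circle) f"
    and fa: "\<And>\<gamma>. \<gamma> \<in> characters A \<Longrightarrow> (if \<gamma> \<in> characters A then \<gamma> a else 0) = f (proj \<gamma>)"
    by (rule fixed_point_descends) blast
  have fp: "f (proj \<gamma>) = \<gamma> a" if "\<gamma> \<in> characters A" for \<gamma> using fa[OF that] that by simp
  have "norm (f z) = 1" if z: "z \<in> {..<n} \<rightarrow>\<^sub>E circle" for z
  proof -
    have "complex_of_real (norm (f z)) = 1"
    proof (rule torus_functions_eqI[where k = "\<lambda>z. complex_of_real (norm (f z))" and k' = "\<lambda>_. 1", OF _ _ _ z])
      show "continuous_on ({..<n} \<rightarrow>\<^sub>E circle) (\<lambda>z. complex_of_real (norm (f z)))"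
        using f by (intro continuous_intros)
      show "complex_of_real (norm (f (proj \<gamma>))) = 1" if "\<gamma> \<in> characters A" for \<gamma>
        using charactersD(2)[OF that a] by (simp add: fp[OF that])
    qed simp
    then show ?thesis by (metis of_real_eq_1_iff)
  qed
  from torus_circle_map[OF f this] obtain m K where K: "continuous_on ({..<n} \<rightarrow>\<^sub>E circle) K"
    and fK: "\<And>z. z \<in> {..<n} \<rightarrow>\<^sub>E circle \<Longrightarrow> f z = (\<Prod>i<n. z i powi m i) * cis (K z)" by blast
  have "a = lincomb A b n m"
  proof (rule character_eqI[OF a A.lincomb_closed[OF b]])
    have "continuous_on (characters A) (\<lambda>\<gamma>. K (proj \<gamma>))"
      using proj_in by (intro continuous_on_compose2[OF K continuous_on_proj]) auto
    then show "continuous_on (characters A) (\<lambda>\<gamma>. (\<Sum>i<n. of_int (m i) * k i \<gamma>) + K (proj \<gamma>))"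
      by (intro continuous_on_add continuous_on_k_sum)
    fix \<gamma> assume \<gamma>: "\<gamma> \<in> characters A"
    have "\<gamma> a = (\<Prod>i<n. u i \<gamma> powi m i) * cis (K (proj \<gamma>))"
      using fp[OF \<gamma>] fK[OF proj_in[OF \<gamma>]] by (simp add: proj_def)
    then show "\<gamma> a = \<gamma> (lincomb A b n m) * cis ((\<Sum>i<n. of_int (m i) * k i \<gamma>) + K (proj \<gamma>))"
      by (simp add: prod_u[OF \<gamma>] flip: cis_mult)
  qed
  then show ?thesis by blast
qed

text \<open>A relation among the \<open>b i\<close> makes a monomial in the \<open>u i\<close> the
  exponential of a continuous phase. This phase descends to the torus, where a nonconstant monomial
  cannot have a single-valued phase.\<close>

lemma coordinates_independent:
  assumes "lincomb A b n c = \<one>\<^bsub>A\<^esub>"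
  shows "\<forall>j<n. c j = 0"
proof (intro allI impI)
  fix j assume j: "j < n"
  define \<kappa> where "\<kappa> \<gamma> = (\<Sum>i<n. of_int (c i) * k i \<gamma>)" for \<gamma>
  have \<kappa>c: "continuous_on (characters A) \<kappa>" unfolding \<kappa>_def by (rule continuous_on_k_sum)
  have uk: "(\<Prod>i<n. u i \<gamma> powi c i) = cis (\<kappa> \<gamma>)" if "\<gamma> \<in> characters A" for \<gamma>
  proof -
    have "\<gamma> \<one>\<^bsub>A\<^esub> = 1" using A.char_lincomb[OF that, of 0] by simp
    then show ?thesis using prod_u[OF that] assms by (simp add: \<kappa>_def)
  qed
  define e where "e = exp_char A (\<lambda>_. 0)"
  have e: "e \<in> characters A" unfolding e_def by (rule exp_char_in_characters[OF A.real_homs_zero A.is_monoid])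
  \<comment> \<open>Since the \<open>u i\<close> are invariant, \<kappa> changes under g by a
    multiple of 2 pi; the multiple is constant by connectedness, and 0 at the trivial character,
    which g fixes.\<close>
  have "\<kappa> (dual_action A (\<phi> g) \<gamma>) = \<kappa> \<gamma>" if g: "g \<in> carrier G" and \<gamma>: "\<gamma> \<in> characters A" for g \<gamma>
  proof -
    define D where "D \<gamma> = (\<kappa> (dual_action A (\<phi> g) \<gamma>) - \<kappa> \<gamma>) / (2 * pi)" for \<gamma>
    have "continuous_on (characters A) (\<lambda>\<gamma>. \<kappa> (dual_action A (\<phi> g) \<gamma>))"
      using dual_action_closed[OF g] by (intro continuous_on_compose2[OF \<kappa>c continuous_on_dual_action]) auto
    then have "continuous_on (characters A) D" unfolding D_def using \<kappa>c by (intro continuous_intros) auto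
    moreover have "D \<gamma> \<in> \<int>" if "\<gamma> \<in> characters A" for \<gamma>
      unfolding D_def using uk[OF that] uk[OF dual_action_closed[OF g that]] u_invariant[OF _ g that]
      by (simp flip: cis_eq_cis_iff)
    ultimately have "D \<gamma> = D e"
      using Ints_valued_constant[OF A.connected_characters[OF torsion_free]] \<gamma> e by blast
    moreover have "dual_action A (\<phi> g) e = e"
      using act_closed[OF g] by (auto simp: dual_action_def e_def exp_char_def)
    ultimately show ?thesis by (simp add: D_def)
  qed
  then have "(\<lambda>\<gamma>. if \<gamma> \<in> characters A then complex_of_real (\<kappa> \<gamma>) else 0) \<in> fixed_point_algebra G A \<phi>"
    using \<kappa>c by (intro fixed_point_algebra_extend continuous_intros) auto
  then obtain f where f: "continuous_on ({..<n} \<rightarrow>\<^sub>E circle) f"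
    and f': "\<And>\<gamma>. \<gamma> \<in> characters A \<Longrightarrow> (if \<gamma> \<in> characters A then complex_of_real (\<kappa> \<gamma>) else 0) = f (proj \<gamma>)"
    by (rule fixed_point_descends) blast
  have fp: "f (proj \<gamma>) = of_real (\<kappa> \<gamma>)" if "\<gamma> \<in> characters A" for \<gamma> using f'[OF that] that by simp
  have nz: "z i \<noteq> 0" if "z \<in> {..<n} \<rightarrow>\<^sub>E circle" "i < n" for z i
    using that by (auto simp: circle_def PiE_def Pi_def)
  \<comment> \<open>The descended f is complex valued, but \<open>cis\<close> takes a real argument;
    that f is real is transported from the dual.\<close>
  have real: "complex_of_real (Re (f z)) = f z" if "z \<in> {..<n} \<rightarrow>\<^sub>E circle" for z
  proof (rule torus_functions_eqI[where k = "\<lambda>z. complex_of_real (Re (f z))" and k' = f, OF _ f _ that])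
    show "continuous_on ({..<n} \<rightarrow>\<^sub>E circle) (\<lambda>z. complex_of_real (Re (f z)))"
      using f by (intro continuous_intros)
    show "complex_of_real (Re (f (proj \<gamma>))) = f (proj \<gamma>)" if "\<gamma> \<in> characters A" for \<gamma>
      by (simp add: fp[OF that])
  qed
  have prod: "(\<Prod>i<n. z i powi c i) = cis (Re (f z))" if z: "z \<in> {..<n} \<rightarrow>\<^sub>E circle" for z
  proof (rule torus_functions_eqI[where k = "\<lambda>z. \<Prod>i<n. z i powi c i" and k' = "\<lambda>z. cis (Re (f z))", OF _ _ _ z])
    show "continuous_on ({..<n} \<rightarrow>\<^sub>E circle) (\<lambda>z. \<Prod>i<n. z i powi c i)"
      using nz by (intro continuous_on_prod continuous_on_power_int continuous_on_coordinate) auto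
    show "continuous_on ({..<n} \<rightarrow>\<^sub>E circle) (\<lambda>z. cis (Re (f z)))"
      using f by (intro continuous_on_cis_comp continuous_intros)
    show "(\<Prod>i<n. proj \<gamma> i powi c i) = cis (Re (f (proj \<gamma>)))" if "\<gamma> \<in> characters A" for \<gamma>
      using uk[OF that] fp[OF that] by (simp add: proj_def)
  qed
  \<comment> \<open>Turning coordinate j once adds 2 pi c j to the argument of the monomial, whereas
    the phase Re f returns to its initial value; as both have the same exponential throughout, c j
    is 0.\<close>
  define loop where "loop s = (\<lambda>i\<in>{..<n}. if i = j then cis s else 1)" for s
  have loop: "loop s \<in> {..<n} \<rightarrow>\<^sub>E circle" for s by (auto simp: loop_def circle_def)
  have loopc: "continuous_on UNIV loop"
  proof (rule continuous_on_coordinatewise_then_product)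
    fix i show "continuous_on UNIV (\<lambda>s. loop s i)"
      by (cases "i < n"; cases "i = j") (simp_all add: loop_def continuous_on_cis_comp)
  qed
  define h where "h s = (of_int (c j) * s - Re (f (loop s))) / (2 * pi)" for s
  have "continuous_on UNIV (\<lambda>s. f (loop s))"
    using loop by (intro continuous_on_compose2[OF f loopc]) auto
  then have "continuous_on UNIV h" unfolding h_def by (intro continuous_intros) auto
  moreover have "h s \<in> \<int>" for s
  proof -
    have "(\<Prod>i<n. loop s i powi c i) = (\<Prod>i<n. if i = j then cis s powi c j else 1)"
      by (intro prod.cong) (auto simp: loop_def)
    also have "\<dots> = cis (of_int (c j) * s)" using j by (simp add: cis_power_int)
    finally show ?thesis unfolding h_def cis_eq_cis_iff[symmetric] using prod[OF loop[of s]] by simp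
  qed
  ultimately have "h (2 * pi) = h 0" using Ints_valued_constant[OF connected_UNIV] by blast
  moreover have "loop (2 * pi) = loop 0"
  proof -
    have "cis (2 * pi) = cis 0" by (simp add: complex_eq_iff)
    then show ?thesis by (simp only: loop_def)
  qed
  ultimately show "c j = 0" by (simp add: h_def diff_divide_distrib)
qed

lemma trivial_action:
  assumes fix_b: "\<And>i g. i < n \<Longrightarrow> g \<in> carrier G \<Longrightarrow> \<phi> g (b i) = b i"
    and g: "g \<in> carrier G" and a: "a \<in> carrier A"
  shows "\<phi> g a = a"
proof (rule ccontr)
  assume neq: "\<phi> g a \<noteq> a"
  obtain t where t: "dual_family A b t n"
    using A.dual_family_of_independent[of n b, OF b coordinates_independent] by blast
  interpret \<phi>g: group_hom A A "\<phi> g"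
    by unfold_locales (rule act_hom[OF g])
  have fix_span: "\<phi> g (lincomb A b m c) = lincomb A b m c" if "m \<le> n" for m c
    using that
  proof (induction m)
    case (Suc m)
    have "\<phi> g (b m [^]\<^bsub>A\<^esub> c m) = b m [^]\<^bsub>A\<^esub> c m"
      using \<phi>g.hom_int_pow[OF b] fix_b[OF _ g] Suc.prems by simp
    then show ?case using Suc b by (simp add: A.lincomb_Suc A.lincomb_closed)
  qed simp
  \<comment> \<open>A power of a in the span would be fixed by \<phi> g. The quotient of \<phi> g a
    by a would then be a torsion element, so a itself would be fixed.\<close>
  have "a [^]\<^bsub>A\<^esub> m \<notin> range (lincomb A b n)" if m: "m > 0" for m :: nat
  proof
    assume "a [^]\<^bsub>A\<^esub> m \<in> range (lincomb A b n)"
    then have "\<phi> g (a [^]\<^bsub>A\<^esub> m) = a [^]\<^bsub>A\<^esub> m" using fix_span by auto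
    then have eq: "\<phi> g a [^]\<^bsub>A\<^esub> m = a [^]\<^bsub>A\<^esub> m" using \<phi>g.hom_nat_pow[OF a] by simp
    have "(\<phi> g a \<otimes>\<^bsub>A\<^esub> inv\<^bsub>A\<^esub> a) [^]\<^bsub>A\<^esub> m = \<one>\<^bsub>A\<^esub>"
      using a act_closed[OF g a] by (simp add: A.nat_pow_distrib A.nat_pow_inv eq)
    then have "\<phi> g a \<otimes>\<^bsub>A\<^esub> inv\<^bsub>A\<^esub> a = \<one>\<^bsub>A\<^esub>"
      using torsion_free[unfolded torsion_free_def, rule_format, of "\<phi> g a \<otimes>\<^bsub>A\<^esub> inv\<^bsub>A\<^esub> a" m] m a act_closed[OF g a]
      by simp
    then show False using neq a act_closed[OF g a] by (metis A.inv_solve_right' A.l_one A.one_closed)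
  qed
  then obtain t' where t': "dual_family A (b(n := a)) t' (Suc n)"
    using A.dual_family_extend[OF t a] by blast
  define S where "S = (b(n := a)) ` {..<Suc n}"
  have S: "finite S" "S \<subseteq> carrier A" using b a by (auto simp: S_def)
  \<comment> \<open>These are the images of the tuple b 0, ..., b (n - 1), a under group elements,
    finite in number because each entry has a finite orbit.\<close>
  define F where "F = (\<lambda>h. restrict (\<lambda>j. \<phi> h ((b(n := a)) j)) {..<Suc n}) ` carrier G"
  have bc: "(b(n := a)) j \<in> carrier A" if "j < Suc n" for j using b a that by auto
  show False
  proof (rule A.rank_le_dimension[OF t' u_continuous u_norm])
    have "F \<subseteq> (\<Pi>\<^sub>E j\<in>{..<Suc n}. orbit G \<phi> ((b(n := a)) j))"
      unfolding F_def by (intro image_subsetI restrict_PiE_iff[THEN iffD2] ballI) (auto simp: orbit_def)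
    moreover have "finite (\<Pi>\<^sub>E j\<in>{..<Suc n}. orbit G \<phi> ((b(n := a)) j))"
      using finite_orbit bc by (intro finite_PiE) auto
    ultimately show "finite F" by (rule finite_subset)
    show "\<sigma> j \<in> carrier A" if "\<sigma> \<in> F" "j < Suc n" for \<sigma> j
      using that act_closed bc by (auto simp: F_def)
    fix \<gamma> \<delta> assume gd: "\<gamma> \<in> characters A" "\<delta> \<in> characters A" "\<forall>i<n. u i \<gamma> = u i \<delta>"
    then have "proj \<gamma> = proj \<delta>" by (auto simp: proj_def)
    then have "f \<gamma> = f \<delta>" if "f \<in> fixed_point_algebra G A \<phi>" for f
      using pullback[OF that] gd(1,2) by (simp add: proj_def)
    then obtain h where h: "h \<in> carrier G" "\<forall>s\<in>S. \<delta> s = \<gamma> (\<phi> h s)"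
      using fixed_point_algebra_separates[OF S gd(1,2)] by blast
    then show "\<exists>\<sigma>\<in>F. \<forall>j<Suc n. \<delta> ((b(n := a)) j) = \<gamma> (\<sigma> j)"
      by (intro bexI[of _ "restrict (\<lambda>j. \<phi> h ((b(n := a)) j)) {..<Suc n}"]) (auto simp: F_def S_def)
  qed
qed

end

theorem trivial_and_free:
  "A \<cong> product_group {..<n} (\<lambda>_. integer_group) \<and> (\<forall>g\<in>carrier G. \<forall>a\<in>carrier A. \<phi> g a = a)"
proof -
  obtain b k where b: "\<And>i. i < n \<Longrightarrow> b i \<in> carrier A" and k: "\<And>i. i < n \<Longrightarrow> continuous_on (characters A) (k i)"
    and ubk: "\<And>i \<gamma>. i < n \<Longrightarrow> \<gamma> \<in> characters A \<Longrightarrow> u i \<gamma> = \<gamma> (b i) * cis (k i \<gamma>)"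
    and fix_b: "\<And>i g. i < n \<Longrightarrow> g \<in> carrier G \<Longrightarrow> \<phi> g (b i) = b i"
    using coordinate_factorization by blast
  have triv: "\<forall>g\<in>carrier G. \<forall>a\<in>carrier A. \<phi> g a = a"
    using trivial_action[OF b k ubk fix_b] by blast
  let ?P = "product_group {..<n} (\<lambda>_. integer_group)"
  have P: "group ?P" by simp
  have "lincomb A b n \<in> iso ?P A"
  proof (rule isoI)
    show "lincomb A b n \<in> hom ?P A"
    proof (rule homI)
      show "lincomb A b n c \<in> carrier A" for c using b by (rule A.lincomb_closed)
      fix c d
      have "lincomb A b n (c \<otimes>\<^bsub>?P\<^esub> d) = lincomb A b n (\<lambda>i. c i + d i)"
        using b by (intro A.lincomb_cong) auto
      then show "lincomb A b n (c \<otimes>\<^bsub>?P\<^esub> d) = lincomb A b n c \<otimes>\<^bsub>A\<^esub> lincomb A b n d"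
        by (simp only: A.lincomb_add[OF b])
    qed
    show "bij_betw (lincomb A b n) (carrier ?P) (carrier A)"
      unfolding bij_betw_def
    proof
      show "inj_on (lincomb A b n) (carrier ?P)"
      proof
        fix c d assume cd: "c \<in> carrier ?P" "d \<in> carrier ?P" "lincomb A b n c = lincomb A b n d"
        have "lincomb A b n (\<lambda>i. c i + (- d i)) = lincomb A b n c \<otimes>\<^bsub>A\<^esub> inv\<^bsub>A\<^esub> lincomb A b n d"
          by (simp only: A.lincomb_add[OF b] A.lincomb_inv[OF b])
        also have "\<dots> = \<one>\<^bsub>A\<^esub>" using cd(3) A.lincomb_closed[OF b] by simp
        finally have diff: "lincomb A b n (\<lambda>i. c i + (- d i)) = \<one>\<^bsub>A\<^esub>" .
        have "\<forall>i<n. c i + (- d i) = 0" by (rule coordinates_independent[OF b k ubk diff])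
        then show "c = d" using cd(1,2) by (intro PiE_ext[of c "{..<n}" "\<lambda>_. UNIV" d]) auto
      qed
      show "lincomb A b n ` carrier ?P = carrier A"
      proof
        show "lincomb A b n ` carrier ?P \<subseteq> carrier A" using A.lincomb_closed[OF b] by auto
        show "carrier A \<subseteq> lincomb A b n ` carrier ?P"
        proof
          fix a assume a: "a \<in> carrier A"
          \<comment> \<open>As the action is already known to be trivial, every element is fixed and
            hence in the span.\<close>
          then obtain c where "a = lincomb A b n c"
            using fixed_in_span[OF b k ubk a] triv by blast
          \<comment> \<open>The product group consists of functions that are
            \<open>undefined\<close> from n on, so the coefficients are restricted to the indices
            that count.\<close>
          also have "\<dots> = lincomb A b n (restrict c {..<n})" using b by (intro A.lincomb_cong) auto
          finally show "a \<in> lincomb A b n ` carrier ?P" by (intro image_eqI[where x = "restrict c {..<n}"]) simp_all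
        qed
      qed
    qed
  qed
  then have "A \<cong> ?P" using group.iso_sym[OF P] is_isoI by blast
  then show ?thesis using triv by blast
qed

end

theorem theorem2p3:
  fixes A :: "('a, 'b) monoid_scheme" and G :: "('g, 'c) monoid_scheme"
    and \<phi> :: "'g \<Rightarrow> 'a \<Rightarrow> 'a" and n :: nat
  assumes "comm_group A" and "torsion_free A"
    and "group G" and "group_action G (carrier A) \<phi>"
    and "\<forall>g\<in>carrier G. \<phi> g \<in> hom A A"
    and "\<forall>a\<in>carrier A. finite (orbit G \<phi> a)"
    and "star_isomorphic (fixed_point_algebra G A \<phi>) (cont_fun (torus n))"
  shows "A \<cong> product_group {..<n} (\<lambda>_. integer_group)
         \<and> (\<forall>g\<in>carrier G. \<forall>a\<in>carrier A. \<phi> g a = a)"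
proof -
  interpret A: comm_group A by fact
  interpret act: group_action G "carrier A" \<phi> by fact
  interpret finite_orbit_action A G \<phi> by unfold_locales (use assms in auto)
  let ?S = "fixed_point_algebra G A \<phi>"
  obtain \<Phi> where \<Phi>: "star_iso \<Phi> ?S (cont_fun (torus n))"
    using assms(7) by (auto simp: star_isomorphic_def)
  have "\<exists>u. (\<forall>i<n. u i \<in> ?S \<and> (\<forall>\<gamma>\<in>characters A. norm (u i \<gamma>) = 1)) \<and>
    (\<forall>f\<in>?S. \<forall>\<gamma>\<in>characters A. f \<gamma> = \<Phi> f (\<lambda>i\<in>{..<n}. u i \<gamma>))"
  proof (rule star_iso_torus_pullback[OF \<Phi>])
    show "(\<lambda>\<gamma>. if \<gamma> \<in> characters A then 1 else 0) \<in> ?S" by (rule fixed_point_algebra_extend) auto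
    show "f \<gamma> = 0" if "f \<in> ?S" "\<gamma> \<notin> characters A" for f \<gamma> using that by (simp add: fixed_point_algebra_iff)
    show "(\<lambda>x. f x + g x) \<in> ?S" "(\<lambda>x. f x * g x) \<in> ?S" if "f \<in> ?S" "g \<in> ?S" for f g
      using that by (auto simp: fixed_point_algebra_iff intro!: continuous_intros)
    show "(\<lambda>x. c * f x) \<in> ?S" "(\<lambda>x. cnj (f x)) \<in> ?S" if "f \<in> ?S" for c f
      using that by (auto simp: fixed_point_algebra_iff intro!: continuous_intros)
  qed
  then obtain u where u: "\<And>i. i < n \<Longrightarrow> u i \<in> ?S" "\<And>i \<gamma>. i < n \<Longrightarrow> \<gamma> \<in> characters A \<Longrightarrow> norm (u i \<gamma>) = 1"
    "\<And>f \<gamma>. f \<in> ?S \<Longrightarrow> \<gamma> \<in> characters A \<Longrightarrow> f \<gamma> = \<Phi> f (\<lambda>i\<in>{..<n}. u i \<gamma>)"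
    by blast
  interpret torus_fixed_points A G \<phi> n u \<Phi>
    by unfold_locales (use \<Phi> u in \<open>auto simp: star_iso_def\<close>)
  show ?thesis by (rule trivial_and_free)
qed

end
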